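(* Let $\mathcal{G}$ be a class of graphs. Then the following statements are equivalent: (1) the class $I(\mathcal{G})$ is $(\mathsf{tw},\omega)$-bounded; (2) the class $I(\mathcal{G})$ has bounded tree-independence number; (3) the class $\mathcal{G}$ has bounded treewidth.
   Context: Graphs are finite and simple. For a class $\mathcal{G}$, $I(\mathcal{G})$ is the class of all graphs $G$ obtained as follows: take $H\in\mathcal{G}$ and a family $\{H_j\}_{j\in J}$ of connected subgraphs of $H$, and let $G$ have vertex set $J$ with distinct $i,j$ adjacent iff $H_i$ and $H_j$ share a vertex. A tree decomposition of $G$ is a pair $(T,\beta)$ with $T$ a tree and $\beta:V(T)\to 2^{V(G)}$ such that every vertex lies in some bag, every edge has both endpoints in some bag, and for each vertex the nodes whose bags contain it induce a subtree. Its width is $\max_t|\beta(t)|-1$ and $\mathsf{tw}(G)$ is the minimum width; its independence number is $\max_t\alpha(G[\beta(t)])$ and $\mathsf{tree}\text{-}\alpha(G)$ is the minimum independence number. $\omega$ is the clique number. A class is $(\mathsf{tw},\omega)$-bounded if there is a function $f$ with $\mathsf{tw}(H)\le f(\omega(H))$ for every induced subgraph $H$ of every graph in the class. *)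

theory Defs
  imports Main
begin

record 'a sgraph =
  verts :: "'a set"
  edges :: "'a set set"

definition simple_graph :: "'a sgraph \<Rightarrow> bool" where
  "simple_graph G \<longleftrightarrow>
     finite (verts G) \<and> (\<forall>e \<in> edges G. e \<subseteq> verts G \<and> card e = 2)"

definition subgraph_of :: "'a sgraph \<Rightarrow> 'a sgraph \<Rightarrow> bool" where
  "subgraph_of H G \<longleftrightarrow> simple_graph H \<and> verts H \<subseteq> verts G \<and> edges H \<subseteq> edges G"

definition induced_subgraph :: "'a sgraph \<Rightarrow> 'a set \<Rightarrow> 'a sgraph" where
  "induced_subgraph G X = \<lparr>verts = X, edges = {e \<in> edges G. e \<subseteq> X}\<rparr>"

text \<open>The graph without vertices is not regarded as connected, hence it is not a tree.\<close>

definition connected_graph :: "'a sgraph \<Rightarrow> bool" where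
  "connected_graph G \<longleftrightarrow> verts G \<noteq> {} \<and>
     (\<forall>u \<in> verts G. \<forall>v \<in> verts G. (u, v) \<in> {(x, y). {x, y} \<in> edges G}\<^sup>*)"

definition cycle_in :: "'a sgraph \<Rightarrow> 'a list \<Rightarrow> bool" where
  "cycle_in G c \<longleftrightarrow> 3 \<le> length c \<and> distinct c \<and>
     (\<forall>i < length c. {c ! i, c ! (Suc i mod length c)} \<in> edges G)"

definition tree_graph :: "'a sgraph \<Rightarrow> bool" where
  "tree_graph T \<longleftrightarrow> simple_graph T \<and> connected_graph T \<and> (\<nexists>c. cycle_in T c)"

definition clique_in :: "'a sgraph \<Rightarrow> 'a set \<Rightarrow> bool" where
  "clique_in G K \<longleftrightarrow>
     K \<subseteq> verts G \<and> (\<forall>u \<in> K. \<forall>v \<in> K. u \<noteq> v \<longrightarrow> {u, v} \<in> edges G)"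

definition independent_in :: "'a sgraph \<Rightarrow> 'a set \<Rightarrow> bool" where
  "independent_in G S \<longleftrightarrow>
     S \<subseteq> verts G \<and> (\<forall>u \<in> S. \<forall>v \<in> S. {u, v} \<notin> edges G)"

definition clique_number :: "'a sgraph \<Rightarrow> nat" where
  "clique_number G = Max (card ` {K. clique_in G K})"

definition independence_number :: "'a sgraph \<Rightarrow> nat" where
  "independence_number G = Max (card ` {S. independent_in G S})"

definition tree_decomposition :: "'a sgraph \<Rightarrow> 't sgraph \<Rightarrow> ('t \<Rightarrow> 'a set) \<Rightarrow> bool" where
  "tree_decomposition G T \<beta> \<longleftrightarrow>
     tree_graph T \<and>
     (\<forall>t \<in> verts T. \<beta> t \<subseteq> verts G) \<and>
     (\<forall>v \<in> verts G. \<exists>t \<in> verts T. v \<in> \<beta> t) \<and>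
     (\<forall>e \<in> edges G. \<exists>t \<in> verts T. e \<subseteq> \<beta> t) \<and>
     (\<forall>v \<in> verts G. tree_graph (induced_subgraph T {t \<in> verts T. v \<in> \<beta> t}))"

text \<open>The width is an integer: the graph without vertices has treewidth \<open>-1\<close>.\<close>

definition td_width :: "'t sgraph \<Rightarrow> ('t \<Rightarrow> 'a set) \<Rightarrow> int" where
  "td_width T \<beta> = int (Max ((\<lambda>t. card (\<beta> t)) ` verts T)) - 1"

definition td_independence :: "'a sgraph \<Rightarrow> 't sgraph \<Rightarrow> ('t \<Rightarrow> 'a set) \<Rightarrow> nat" where
  "td_independence G T \<beta> =
     Max ((\<lambda>t. independence_number (induced_subgraph G (\<beta> t))) ` verts T)"

text \<open>Decomposition trees are finite, so node type \<^typ>\<open>nat\<close> captures all of them up to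
  isomorphism.\<close>

definition treewidth :: "'a sgraph \<Rightarrow> int" where
  "treewidth G =
     (LEAST w. \<exists>(T :: nat sgraph) \<beta>. tree_decomposition G T \<beta> \<and> w = td_width T \<beta>)"

definition tree_independence_number :: "'a sgraph \<Rightarrow> nat" where
  "tree_independence_number G =
     (LEAST k. \<exists>(T :: nat sgraph) \<beta>. tree_decomposition G T \<beta> \<and> k = td_independence G T \<beta>)"

definition intersection_graph :: "'j set \<Rightarrow> ('j \<Rightarrow> 'a sgraph) \<Rightarrow> 'j sgraph" where
  "intersection_graph J S =
     \<lparr>verts = J,
      edges = {{i, j} | i j. i \<in> J \<and> j \<in> J \<and> i \<noteq> j \<and> verts (S i) \<inter> verts (S j) \<noteq> {}}\<rparr>"

text \<open>\<open>J\<close> ranges over all finite sets of naturals, so every graph of the class is represented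
  up to isomorphism.\<close>

definition intersection_class :: "'a sgraph set \<Rightarrow> nat sgraph set" where
  "intersection_class \<G> =
     {intersection_graph J S | J S H.
        H \<in> \<G> \<and> finite J \<and> (\<forall>j \<in> J. subgraph_of (S j) H \<and> connected_graph (S j))}"

definition tw_omega_bounded :: "'a sgraph set \<Rightarrow> bool" where
  "tw_omega_bounded \<C> \<longleftrightarrow>
     (\<exists>f :: nat \<Rightarrow> nat. \<forall>G \<in> \<C>. \<forall>X \<subseteq> verts G.
        treewidth (induced_subgraph G X) \<le> int (f (clique_number (induced_subgraph G X))))"

definition bounded_tree_independence :: "'a sgraph set \<Rightarrow> bool" where
  "bounded_tree_independence \<C> \<longleftrightarrow> (\<exists>k :: nat. \<forall>G \<in> \<C>. tree_independence_number G \<le> k)"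

definition bounded_treewidth :: "'a sgraph set \<Rightarrow> bool" where
  "bounded_treewidth \<C> \<longleftrightarrow> (\<exists>k :: nat. \<forall>G \<in> \<C>. treewidth G \<le> int k)"

end

theory Submission
  imports Defs "HOL-Library.Ramsey" "HOL-Library.Nat_Bijection"
begin

text \<open>If \<open>H\<close> has a tree decomposition with bags of size at most \<open>k + 1\<close>, replacing every bag by the
  set of members of the family that meet it gives a tree decomposition of the intersection graph
  with bags of independence number at most \<open>k + 1\<close>; Ramsey's theorem then bounds the bags in terms
  of the clique number.

  The remaining implication follows Reed and Wood (grid-like minors) and does not need the grid
  minor theorem. If \<open>H\<close> has large treewidth, some vertex set \<open>W\<close> has no small balanced separator, so the
  connected sets containing more than half of \<open>W\<close> form a pairwise intersecting family that no small
  set covers. A path meeting all of them is cut into disjoint segments \<open>P i\<close>, any two of which cannot be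
  separated by few vertices, so by Menger's theorem they are joined by many disjoint paths. If all
  triangle-free intersection graphs over \<open>H\<close> had small treewidth, two such linkages could not contain
  large subfamilies that meet completely, hence one path \<open>Q (i, j)\<close> per pair can be chosen such that the
  chosen paths are pairwise disjoint. But then the bipartite intersection graph of the
  \<open>P i\<close> and \<open>Q (i, j)\<close> has large treewidth, a contradiction.\<close>

section \<open>Walks and connected vertex sets\<close>

text \<open>The implications form the cycle (1), (3), (2), (1). In (1) to (3) nothing is known about
  the function \<open>f\<close>, so it may be evaluated at boundedly many arguments only: the
  intersection graph of the chosen sets is bipartite, hence has clique number at most 2, and
  \<open>w\<close> is the maximum of \<open>f\<close> at 0, 1, 2. The obstacle is that linkages of
  different pairs of segments may cross. Two families of \<open>m * m\<close> disjoint paths, each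
  path of one meeting each of the other, are themselves a grid-like minor: \<open>m\<close> paths of
  the first act as segments, and paths of the second, indexed by pairs, as connectors. So
  \<open>grid_like_minor_bound\<close> serves twice, and a greedy choice can disentangle the
  linkages. Constants: a grid-like minor of order \<open>m\<close> forces
  \<open>m \<le> 2 * (w + 1)\<close>, which \<open>m = 2 * w + 3\<close> violates; \<open>k\<close>
  is a linkage size large enough for the greedy choice; \<open>m * k\<close> is the cover number
  that pays for \<open>m\<close> segments of cover number \<open>k\<close> each; the factor 3 comes
  from bags of size \<open>3 * (m * k) + 1\<close> in the recursive separation.\<close>

definition adj_in :: "'a set set \<Rightarrow> 'a set \<Rightarrow> ('a \<times> 'a) set" where
  "adj_in E X = {(x, y). x \<in> X \<and> y \<in> X \<and> {x, y} \<in> E}"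

text \<open>Connectivity of a vertex set instead of a graph: paths are confined to \<open>X\<close>
  without forming a subgraph, and the edge set stays a free parameter, as the induction in Menger's
  theorem requires.\<close>

definition conn :: "'a set set \<Rightarrow> 'a set \<Rightarrow> bool" where
  "conn E X \<longleftrightarrow> X \<noteq> {} \<and> (\<forall>u \<in> X. \<forall>v \<in> X. (u, v) \<in> (adj_in E X)\<^sup>*)"

text \<open>No vertex set is involved: \<open>[v]\<close> is a walk for every \<open>v\<close>, so a
  common vertex of both sides counts as a path in Menger's theorem. Vertices may repeat.\<close>

definition walk :: "'a set set \<Rightarrow> 'a list \<Rightarrow> bool" where
  "walk E xs \<longleftrightarrow> xs \<noteq> [] \<and> successively (\<lambda>x y. {x, y} \<in> E) xs"

lemma adj_in_mono: "E \<subseteq> E' \<Longrightarrow> X \<subseteq> Y \<Longrightarrow> adj_in E X \<subseteq> adj_in E' Y"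
  by (auto simp: adj_in_def)

lemma rtrancl_adj_in_mono:
  "(u, v) \<in> (adj_in E X)\<^sup>* \<Longrightarrow> E \<subseteq> E' \<Longrightarrow> X \<subseteq> Y \<Longrightarrow> (u, v) \<in> (adj_in E' Y)\<^sup>*"
  using rtrancl_mono[OF adj_in_mono] by blast

lemma rtrancl_adj_in_sym: "(u, v) \<in> (adj_in E X)\<^sup>* \<Longrightarrow> (v, u) \<in> (adj_in E X)\<^sup>*"
  by (rule symD[OF sym_rtrancl]) (auto simp: adj_in_def sym_def insert_commute)

lemma rtrancl_adj_in_closed: "(u, v) \<in> (adj_in E X)\<^sup>* \<Longrightarrow> u \<in> X \<Longrightarrow> v \<in> X"
  by (induction rule: rtrancl_induct) (auto simp: adj_in_def)

lemma connI_root: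
  assumes "r \<in> X" "\<And>v. v \<in> X \<Longrightarrow> (r, v) \<in> (adj_in E X)\<^sup>*"
  shows "conn E X"
  unfolding conn_def using assms by (meson empty_iff rtrancl_adj_in_sym rtrancl_trans)

lemma conn_mono: "conn E X \<Longrightarrow> E \<subseteq> E' \<Longrightarrow> conn E' X"
  unfolding conn_def by (meson order_refl rtrancl_adj_in_mono)

lemma conn_cong:
  assumes "\<And>e. e \<subseteq> X \<Longrightarrow> e \<in> E \<longleftrightarrow> e \<in> E'"
  shows "conn E X \<longleftrightarrow> conn E' X"
proof -
  have "adj_in E X = adj_in E' X"
    using assms by (auto simp: adj_in_def)
  then show ?thesis
    by (simp add: conn_def)
qed

lemma conn_Un:
  assumes "conn E X" "conn E Y" "X \<inter> Y \<noteq> {}"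
  shows "conn E (X \<union> Y)"
proof -
  obtain r where r: "r \<in> X" "r \<in> Y"
    using assms by auto
  show ?thesis
  proof (rule connI_root)
    show "r \<in> X \<union> Y"
      using r by auto
    fix v assume "v \<in> X \<union> Y"
    then consider "(r, v) \<in> (adj_in E X)\<^sup>*" | "(r, v) \<in> (adj_in E Y)\<^sup>*"
      using assms r unfolding conn_def by blast
    then show "(r, v) \<in> (adj_in E (X \<union> Y))\<^sup>*"
      by cases (auto elim: rtrancl_adj_in_mono)
  qed
qed

lemma connected_graph_iff_conn:
  assumes "simple_graph G"
  shows "connected_graph G \<longleftrightarrow> conn (edges G) (verts G)"
proof -
  have "{(x, y). {x, y} \<in> edges G} = adj_in (edges G) (verts G)"
    using assms by (auto simp: simple_graph_def adj_in_def)
  then show ?thesis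
    by (simp add: connected_graph_def conn_def)
qed

lemma walk_singleton [simp]: "walk E [v]"
  by (simp add: walk_def)

lemma walk_append:
  "walk E (xs @ ys) \<longleftrightarrow>
     (if xs = [] then walk E ys else if ys = [] then walk E xs
      else walk E xs \<and> walk E ys \<and> {last xs, hd ys} \<in> E)"
  by (auto simp: walk_def successively_append_iff)

lemma walk_Cons:
  "walk E (x # xs) \<longleftrightarrow> xs = [] \<or> {x, hd xs} \<in> E \<and> walk E xs"
  by (auto simp: walk_def successively_Cons)

lemma walk_rev: "walk E (rev xs) \<longleftrightarrow> walk E xs"
  by (simp add: walk_def insert_commute)

lemma walk_mono: "walk E xs \<Longrightarrow> E \<subseteq> E' \<Longrightarrow> walk E' xs"
  unfolding walk_def by (auto elim: successively_mono)

lemma walk_join: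
  assumes "walk E p" "walk E q" "last p = hd q"
  shows "walk E (p @ tl q)" "hd (p @ tl q) = hd p" "last (p @ tl q) = last q"
    "set (p @ tl q) = set p \<union> set q"
proof -
  obtain a q' where q: "q = a # q'"
    using assms(2) by (cases q) (auto simp: walk_def)
  have p: "p \<noteq> []"
    using assms(1) by (simp add: walk_def)
  show "walk E (p @ tl q)" "hd (p @ tl q) = hd p" "last (p @ tl q) = last q"
    "set (p @ tl q) = set p \<union> set q"
    using assms p unfolding q by (auto simp: walk_append walk_Cons dest: last_in_set)
qed

lemma walk_of_rtrancl:
  assumes "(u, v) \<in> (adj_in E X)\<^sup>*" "u \<in> X"
  shows "\<exists>xs. walk E xs \<and> distinct xs \<and> hd xs = u \<and> last xs = v \<and> set xs \<subseteq> X"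
  using assms
proof (induction rule: rtrancl_induct)
  case base
  then show ?case
    by (intro exI[of _ "[u]"]) auto
next
  case (step y z)
  then obtain xs where xs: "walk E xs" "distinct xs" "hd xs = u" "last xs = y" "set xs \<subseteq> X"
    by auto
  show ?case
  proof (cases "z \<in> set xs")
    case True
    then obtain as bs where "xs = as @ z # bs"
      by (meson split_list)
    then show ?thesis
      using xs by (intro exI[of _ "as @ [z]"]) (auto simp: walk_append walk_Cons hd_append split: if_splits)
  next
    case False
    have "xs \<noteq> []"
      using xs(1) by (simp add: walk_def)
    with False show ?thesis
      using xs step.hyps
      by (intro exI[of _ "xs @ [z]"]) (auto simp: walk_append walk_Cons adj_in_def)
  qed
qed

lemma conn_walk_exists:
  assumes "conn E X" "u \<in> X" "v \<in> X"
  obtains xs where "walk E xs" "distinct xs" "hd xs = u" "last xs = v" "set xs \<subseteq> X"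
  using assms walk_of_rtrancl[of u v E X] by (auto simp: conn_def)

lemma conn_walk: "walk E xs \<Longrightarrow> conn E (set xs)"
proof (induction xs rule: induct_list012)
  case 1
  then show ?case by (simp add: walk_def)
next
  case (2 x)
  then show ?case by (simp add: conn_def)
next
  case (3 x y zs)
  then have "{x, y} \<in> E" "conn E (set (y # zs))"
    by (auto simp: walk_Cons)
  moreover from this have "conn E {x, y}"
    by (intro connI_root[of x]) (auto simp: adj_in_def insert_commute)
  ultimately have "conn E ({x, y} \<union> set (y # zs))"
    by (intro conn_Un) auto
  then show ?case
    by (simp add: insert_commute)
qed

lemma walk_first_hit:
  assumes "walk E xs" "set xs \<inter> S \<noteq> {}"
  obtains ys s zs where "xs = (ys @ [s]) @ zs" "walk E (ys @ [s])" "hd (ys @ [s]) = hd xs"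
    "s \<in> S" "set ys \<inter> S = {}"
proof -
  have "\<exists>x\<in>set xs. x \<in> S"
    using assms(2) by auto
  then obtain ys s zs where *: "xs = ys @ s # zs" "s \<in> S" "\<forall>y\<in>set ys. y \<notin> S"
    by (rule split_list_first_propE)
  show ?thesis
  proof (rule that)
    show "walk E (ys @ [s])"
      using assms(1) * by (auto simp: walk_append walk_Cons split: if_splits)
    show "hd (ys @ [s]) = hd xs"
      using * by (cases ys) auto
  qed (use * in auto)
qed

lemma walk_prefix_avoiding:
  assumes "walk E p" "v \<in> set p" "v \<notin> S" "set (butlast p) \<inter> S = {}"
  obtains q where "walk E q" "hd q = hd p" "last q = v" "set q \<inter> S = {}" "set q \<subseteq> set p"
proof -
  obtain as bs where p: "p = as @ v # bs"
    using assms(2) by (meson split_list)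
  show ?thesis
  proof (rule that)
    show "walk E (as @ [v])"
      using assms(1) p by (auto simp: walk_append walk_Cons split: if_splits)
    show "hd (as @ [v]) = hd p"
      using p by (cases as) auto
    have "set as \<subseteq> set (butlast p)"
      using p by (auto simp: butlast_append)
    then show "set (as @ [v]) \<inter> S = {}"
      using assms by auto
    show "set (as @ [v]) \<subseteq> set p"
      using p by auto
  qed auto
qed

section \<open>Menger's theorem\<close>

text \<open>Repeated vertices and further visits to \<open>A\<close> or \<open>B\<close> are
  allowed. This is harmless, since only disjointness of the vertex sets of different paths is
  counted.\<close>

definition link :: "'a set set \<Rightarrow> 'a set \<Rightarrow> 'a set \<Rightarrow> 'a list \<Rightarrow> bool" where
  "link E A B xs \<longleftrightarrow> walk E xs \<and> hd xs \<in> A \<and> last xs \<in> B"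

lemma link_rev: "link E A B (rev xs) \<longleftrightarrow> link E B A xs"
  by (auto simp: link_def walk_rev hd_rev last_rev)

text \<open>Every edge of the walk has its earlier endpoint in \<open>ys\<close>, so none of them is
  the new edge, even if the final vertex \<open>s\<close> is \<open>x\<close> or
  \<open>y\<close>.\<close>

lemma walk_insert_edge_avoiding:
  assumes "walk (insert {x, y} E) (ys @ [s])" "set ys \<inter> {x, y} = {}"
  shows "walk E (ys @ [s])"
  using assms
proof (induction ys)
  case (Cons a ys)
  have "{a, hd (ys @ [s])} \<noteq> {x, y}"
    using Cons.prems by (auto simp: doubleton_eq_iff)
  then show ?case
    using Cons by (auto simp: walk_Cons)
qed auto

lemma walk_insert_edge_avoiding':
  assumes "walk (insert {x, y} E) xs" "set xs \<inter> {x, y} = {}"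
  shows "walk E xs"
proof -
  have "xs = butlast xs @ [last xs]"
    using assms by (simp add: walk_def)
  moreover have "set (butlast xs) \<inter> {x, y} = {}"
    using assms(2) by (auto dest: in_set_butlastD)
  ultimately show ?thesis
    using assms walk_insert_edge_avoiding by metis
qed

text \<open>This lets the hypothesis of Menger's theorem pass from \<open>A\<close>,
  \<open>B\<close> with the new edge to \<open>A\<close>, \<open>insert x S\<close> without it. The
  walk is truncated at its first vertex in \<open>S \<union> {x, y}\<close>; such a vertex exists
  because \<open>S\<close> separates in \<open>E\<close>, the truncated walk does not use the new
  edge, and by \<open>ny\<close> it cannot end in \<open>y\<close> outside \<open>S\<close>.\<close>

lemma separator_insert_endpoint:
  assumes sep: "\<And>xs. link E A B xs \<Longrightarrow> set xs \<inter> S \<noteq> {}"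
    and ny: "\<And>xs. link E A {y} xs \<Longrightarrow> set xs \<inter> S \<noteq> {}"
    and xs: "link (insert {x, y} E) A B xs" "set xs \<inter> T = {}"
  shows "\<exists>ys. link E A (insert x S) ys \<and> set ys \<inter> T = {}"
proof -
  have w: "walk (insert {x, y} E) xs" "hd xs \<in> A" "last xs \<in> B"
    using xs by (auto simp: link_def)
  have hit: "set xs \<inter> (S \<union> {x, y}) \<noteq> {}"
  proof
    assume *: "set xs \<inter> (S \<union> {x, y}) = {}"
    then have "walk E xs"
      using w walk_insert_edge_avoiding'[of x y E xs] by blast
    then show False
      using sep[of xs] w * by (auto simp: link_def)
  qed
  obtain ys s zs where ys: "xs = (ys @ [s]) @ zs" "walk (insert {x, y} E) (ys @ [s])"
    "hd (ys @ [s]) = hd xs" "s \<in> S \<union> {x, y}" "set ys \<inter> (S \<union> {x, y}) = {}"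
    using walk_first_hit[OF w(1) hit] by metis
  have wE: "walk E (ys @ [s])"
    using walk_insert_edge_avoiding[OF ys(2)] ys(5) by auto
  have "s \<in> insert x S"
  proof (rule ccontr)
    assume "s \<notin> insert x S"
    then have "link E A {y} (ys @ [s])" "set (ys @ [s]) \<inter> S = {}"
      using wE ys w by (auto simp: link_def)
    then show False
      using ny[of "ys @ [s]"] by blast
  qed
  then have "link E A (insert x S) (ys @ [s])"
    unfolding link_def using wE ys(3) w(2) by (metis last_snoc)
  then show ?thesis
    using xs(2) ys(1) by (intro exI[of _ "ys @ [s]"]) auto
qed

text \<open>Truncating each path at its first vertex in \<open>Z\<close> gives disjoint paths with
  distinct ends in \<open>Z\<close>. As \<open>Z\<close> has no more elements than \<open>P\<close>,
  the ends exhaust \<open>Z\<close>, and the paths can be indexed by their ends.\<close>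

lemma linkage_onto:
  assumes P: "pairwise (\<lambda>p q. set p \<inter> set q = {}) P" "\<And>p. p \<in> P \<Longrightarrow> link E A Z p"
    and Z: "finite Z" "card Z \<le> card P"
  obtains g where "card Z = card P"
    "\<And>s. s \<in> Z \<Longrightarrow> walk E (g s) \<and> hd (g s) \<in> A \<and> last (g s) = s \<and> set (butlast (g s)) \<inter> Z = {}"
    "\<And>s t. s \<in> Z \<Longrightarrow> t \<in> Z \<Longrightarrow> s \<noteq> t \<Longrightarrow> set (g s) \<inter> set (g t) = {}"
proof -
  have "\<forall>p\<in>P. \<exists>q. walk E q \<and> hd q \<in> A \<and> last q \<in> Z \<and> set (butlast q) \<inter> Z = {} \<and> set q \<subseteq> set p"
  proof
    fix p assume "p \<in> P"
    then have p: "walk E p" "hd p \<in> A" "last p \<in> Z"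
      using P by (auto simp: link_def)
    then have "set p \<inter> Z \<noteq> {}"
      by (auto simp: walk_def dest!: last_in_set)
    then obtain ys s zs where "p = (ys @ [s]) @ zs" "walk E (ys @ [s])" "hd (ys @ [s]) = hd p"
      "s \<in> Z" "set ys \<inter> Z = {}"
      using walk_first_hit p(1) by metis
    then show "\<exists>q. walk E q \<and> hd q \<in> A \<and> last q \<in> Z \<and> set (butlast q) \<inter> Z = {} \<and> set q \<subseteq> set p"
      using p by (intro exI[of _ "ys @ [s]"]) auto
  qed
  then obtain h where h: "\<And>p. p \<in> P \<Longrightarrow> walk E (h p) \<and> hd (h p) \<in> A \<and> last (h p) \<in> Z \<and>
      set (butlast (h p)) \<inter> Z = {} \<and> set (h p) \<subseteq> set p"
    by metis
  define l where "l = (\<lambda>p. last (h p))"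
  have l_in: "l p \<in> set p" if "p \<in> P" for p
    using h[OF that] unfolding l_def walk_def by auto
  have inj: "inj_on l P"
  proof (rule inj_onI)
    fix p q assume pq: "p \<in> P" "q \<in> P" "l p = l q"
    then have "set p \<inter> set q \<noteq> {}"
      using l_in by (metis IntI empty_iff)
    then show "p = q"
      using P(1) pq by (auto simp: pairwise_def)
  qed
  have sub: "l ` P \<subseteq> Z"
    using h by (auto simp: l_def)
  have img: "l ` P = Z"
    using inj sub Z card_image[OF inj] card_mono[OF Z(1) sub] by (intro card_subset_eq) auto
  define g where "g = (\<lambda>s. h (inv_into P l s))"
  have inv: "inv_into P l s \<in> P" "l (inv_into P l s) = s" if "s \<in> Z" for s
    using inv_into_into[of s l P] f_inv_into_f[of s l P] that unfolding img by auto
  show ?thesis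
  proof (rule that[of g])
    show "card Z = card P"
      using img inj by (metis card_image)
    show "walk E (g s) \<and> hd (g s) \<in> A \<and> last (g s) = s \<and> set (butlast (g s)) \<inter> Z = {}" if "s \<in> Z" for s
      using h[OF inv(1)[OF that]] inv(2)[OF that] by (simp add: g_def l_def)
    show "set (g s) \<inter> set (g t) = {}" if st: "s \<in> Z" "t \<in> Z" "s \<noteq> t" for s t
    proof -
      have "inv_into P l s \<noteq> inv_into P l t"
        using inv(2) st by metis
      then have "set (inv_into P l s) \<inter> set (inv_into P l t) = {}"
        using P(1) inv(1) st by (auto simp: pairwise_def)
      then show ?thesis
        using h[OF inv(1)[OF st(1)]] h[OF inv(1)[OF st(2)]] by (auto simp: g_def)
    qed
  qed
qed

text \<open>The paths from \<open>A\<close> and from \<open>B\<close> that end in the same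
  \<open>s \<in> S\<close> are joined at \<open>s\<close>; those ending in \<open>x\<close> and
  \<open>y\<close> are joined by the new edge. The separator \<open>S\<close> prevents all other
  crossings.\<close>

lemma combine_linkages:
  assumes sep: "\<And>xs. link E A B xs \<Longrightarrow> set xs \<inter> S \<noteq> {}"
    and fin: "finite S" and xy: "x \<notin> S" "y \<notin> S"
    and g: "\<And>s. s \<in> insert x S \<Longrightarrow>
        walk E (g s) \<and> hd (g s) \<in> A \<and> last (g s) = s \<and> set (butlast (g s)) \<inter> insert x S = {}"
      "\<And>s t. s \<in> insert x S \<Longrightarrow> t \<in> insert x S \<Longrightarrow> s \<noteq> t \<Longrightarrow> set (g s) \<inter> set (g t) = {}"
    and h: "\<And>s. s \<in> insert y S \<Longrightarrow>
        walk E (h s) \<and> hd (h s) \<in> B \<and> last (h s) = s \<and> set (butlast (h s)) \<inter> insert y S = {}"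
      "\<And>s t. s \<in> insert y S \<Longrightarrow> t \<in> insert y S \<Longrightarrow> s \<noteq> t \<Longrightarrow> set (h s) \<inter> set (h t) = {}"
  shows "\<exists>P. finite P \<and> card P = Suc (card S) \<and> pairwise (\<lambda>p q. set p \<inter> set q = {}) P \<and>
    (\<forall>p \<in> P. link (insert {x, y} E) A B p)"
proof -
  \<comment> \<open>\<open>\<sigma> s\<close> is the end of the path from \<open>B\<close> that
    continues the path from \<open>A\<close> ending in \<open>s\<close>.\<close>
  define \<sigma> where "\<sigma> = (\<lambda>s. if s = x then y else s)"
  define c where "c = (\<lambda>s. if s = x then g x @ rev (h y) else g s @ tl (rev (h s)))"
  have c: "link (insert {x, y} E) A B (c s) \<and> set (c s) = set (g s) \<union> set (h (\<sigma> s))"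
    if s: "s \<in> insert x S" for s
  proof (cases "s = x")
    case True
    have gx: "walk E (g x)" "hd (g x) \<in> A" "last (g x) = x" using g(1)[of x] by auto
    have hy: "walk E (h y)" "hd (h y) \<in> B" "last (h y) = y" using h(1)[of y] by auto
    have "walk (insert {x, y} E) (g x)" "walk (insert {x, y} E) (rev (h y))"
      using gx hy by (auto simp: walk_rev intro: walk_mono)
    moreover have "g x \<noteq> []" "h y \<noteq> []"
      using gx hy by (auto simp: walk_def)
    ultimately show ?thesis
      using True gx hy by (auto simp: c_def \<sigma>_def link_def walk_append hd_rev last_rev)
  next
    case False
    then have sS: "s \<in> S" using s by auto
    have gs: "walk E (g s)" "hd (g s) \<in> A" "last (g s) = s" using g(1)[OF s] by auto
    have hs: "walk E (rev (h s))" "last (rev (h s)) \<in> B" "hd (rev (h s)) = s"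
      using h(1)[of s] sS by (auto simp: walk_rev hd_rev last_rev)
    note j = walk_join[OF gs(1) hs(1), unfolded gs(3) hs(3), OF refl]
    show ?thesis
      using False j gs hs walk_mono[OF j(1), of "insert {x, y} E"]
      by (auto simp: c_def \<sigma>_def link_def)
  qed
  \<comment> \<open>At a common vertex in \<open>S\<close> both paths end, so
    \<open>s = \<sigma> t\<close> lies in \<open>S\<close>, contradicting
    \<open>s \<noteq> t\<close>. At a common vertex outside \<open>S\<close>, the two initial pieces
    combine to a walk from \<open>A\<close> to \<open>B\<close> in \<open>E\<close> that avoids
    \<open>S\<close>.\<close>
  have cross: "set (g s) \<inter> set (h (\<sigma> t)) = {}" if st: "s \<in> insert x S" "t \<in> insert x S" "s \<noteq> t" for s t
  proof (rule ccontr)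
    assume "set (g s) \<inter> set (h (\<sigma> t)) \<noteq> {}"
    then obtain v where v: "v \<in> set (g s)" "v \<in> set (h (\<sigma> t))" by auto
    have \<sigma>t: "\<sigma> t \<in> insert y S"
      using st by (auto simp: \<sigma>_def)
    note gs = g(1)[OF st(1)] and ht = h(1)[OF \<sigma>t]
    show False
    proof (cases "v \<in> S")
      case True
      have "v = last (g s)"
        using gs True v(1) by (cases "g s" rule: rev_cases) auto
      moreover have "v = last (h (\<sigma> t))"
        using ht True v(2) by (cases "h (\<sigma> t)" rule: rev_cases) auto
      ultimately have "s = \<sigma> t" "\<sigma> t \<in> S"
        using gs ht True by auto
      then show False
        using st xy by (auto simp: \<sigma>_def split: if_splits)
    next
      case False
      obtain p where p: "walk E p" "hd p = hd (g s)" "last p = v" "set p \<inter> S = {}"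
        using gs walk_prefix_avoiding[of E "g s" v S] v False by (metis Int_insert_right inf.commute insert_not_empty)
      obtain q where q: "walk E q" "hd q = hd (h (\<sigma> t))" "last q = v" "set q \<inter> S = {}"
        using ht walk_prefix_avoiding[of E "h (\<sigma> t)" v S] v False by (metis Int_insert_right inf.commute insert_not_empty)
      have q': "walk E (rev q)" "hd (rev q) = v" "last (rev q) = hd (h (\<sigma> t))"
        using q by (auto simp: walk_rev hd_rev last_rev)
      note j = walk_join[OF p(1) q'(1), unfolded p(3) q'(2), OF refl]
      have "link E A B (p @ tl (rev q))"
        using j p q' gs ht by (auto simp: link_def)
      from sep[OF this] show False
        unfolding j(4) using p q by auto
    qed
  qed
  have disj: "set (c s) \<inter> set (c t) = {}" if st: "s \<in> insert x S" "t \<in> insert x S" "s \<noteq> t" for s t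
  proof -
    have "\<sigma> s \<in> insert y S" "\<sigma> t \<in> insert y S" "\<sigma> s \<noteq> \<sigma> t"
      using st xy by (auto simp: \<sigma>_def)
    then have "set (h (\<sigma> s)) \<inter> set (h (\<sigma> t)) = {}"
      using h(2) by blast
    then show ?thesis
      using c[OF st(1)] c[OF st(2)] g(2)[OF st] cross[OF st] cross[OF st(2,1)] st(3) by blast
  qed
  have ne: "set (c s) \<noteq> {}" if "s \<in> insert x S" for s
    using c[OF that] by (auto simp: link_def walk_def)
  have inj: "inj_on c (insert x S)"
    using disj ne by (metis inf.idem inj_onI)
  show ?thesis
  proof (intro exI[of _ "c ` insert x S"] conjI)
    show "card (c ` insert x S) = Suc (card S)"
      using fin xy card_image[OF inj] by simp
    show "pairwise (\<lambda>p q. set p \<inter> set q = {}) (c ` insert x S)"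
      unfolding pairwise_def using disj by fast
  qed (use fin c in auto)
qed

text \<open>Induction on the edges in the style of Goering. If \<open>E\<close> without the edge
  \<open>e\<close> has a separator \<open>S\<close> with fewer than \<open>k\<close> vertices, then
  the sets \<open>S\<close> plus either end of \<open>e\<close> are linked by induction to
  \<open>A\<close> and to \<open>B\<close> respectively, and the two linkages are combined across
  \<open>e\<close>.\<close>

theorem menger:
  assumes "finite E" "\<And>e. e \<in> E \<Longrightarrow> card e = 2" "finite A" "finite B"
    "\<And>S. finite S \<Longrightarrow> card S < k \<Longrightarrow> \<exists>xs. link E A B xs \<and> set xs \<inter> S = {}"
  shows "\<exists>P. finite P \<and> card P = k \<and> pairwise (\<lambda>p q. set p \<inter> set q = {}) P \<and> (\<forall>p \<in> P. link E A B p)"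
  using assms
proof (induction E arbitrary: A B rule: finite_induct)
  case empty
  \<comment> \<open>Without edges a walk is a single vertex, so \<open>A \<inter> B\<close> itself
    meets every link.\<close>
  have "\<not> card (A \<inter> B) < k"
  proof
    assume "card (A \<inter> B) < k"
    then obtain xs where xs: "link {} A B xs" "set xs \<inter> (A \<inter> B) = {}"
      using empty(4)[of "A \<inter> B"] empty(2) by auto
    then have "walk {} xs"
      by (simp add: link_def)
    then have "\<exists>a. xs = [a]"
      by (cases xs) (simp_all add: walk_Cons, simp add: walk_def)
    then show False
      using xs by (auto simp: link_def)
  qed
  then obtain C where C: "C \<subseteq> A \<inter> B" "card C = k" "finite C"
    by (meson not_less obtain_subset_with_card_n)
  show ?case
    using C by (intro exI[of _ "(\<lambda>v. [v]) ` C"])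
      (auto simp: card_image inj_on_def pairwise_def link_def)
next
  case (insert e E A B)
  note finA = insert.prems(2) and finB = insert.prems(3)
  have cE: "\<And>e. e \<in> E \<Longrightarrow> card e = 2"
    using insert.prems by auto
  show ?case
  proof (cases "\<forall>S. finite S \<longrightarrow> card S < k \<longrightarrow> (\<exists>xs. link E A B xs \<and> set xs \<inter> S = {})")
    case True
    then obtain P where "finite P" "card P = k" "pairwise (\<lambda>p q. set p \<inter> set q = {}) P" "\<forall>p \<in> P. link E A B p"
      using insert.IH[of A B] cE finA finB by blast
    then show ?thesis
      by (intro exI[of _ P]) (auto simp: link_def intro: walk_mono)
  next
    case False
    then obtain S where S: "finite S" "card S < k"
      and sep: "\<And>xs. link E A B xs \<Longrightarrow> set xs \<inter> S \<noteq> {}"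
      by auto
    have sep': "\<And>xs. link E B A xs \<Longrightarrow> set xs \<inter> S \<noteq> {}"
      using sep by (metis link_rev set_rev)
    obtain a b where e: "e = {a, b}" "a \<noteq> b"
      using insert.prems(1)[of e] by (auto simp: card_2_iff)
    obtain w where w: "link (insert e E) A B w" "set w \<inter> S = {}"
      using insert.prems(4) S by blast
    have hit: "set w \<inter> {a, b} \<noteq> {}"
    proof
      assume "set w \<inter> {a, b} = {}"
      then have "link E A B w"
        using w walk_insert_edge_avoiding'[of a b E w] by (auto simp: link_def e)
      then show False
        using sep w by auto
    qed
    \<comment> \<open>Applied to \<open>w\<close> and to its reversal, this orients the new edge:
      \<open>x\<close> is the end reached from \<open>A\<close> and \<open>y\<close> the end reached
      from \<open>B\<close>, both within \<open>E\<close> and avoiding \<open>S\<close>.\<close>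
    have first_end: "\<exists>x\<in>{a, b}. \<exists>p. walk E p \<and> hd p = hd w \<and> last p = x \<and> set p \<inter> S = {}"
      if w: "walk (insert e E) w" "set w \<inter> S = {}" "set w \<inter> {a, b} \<noteq> {}" for w
    proof -
      obtain ys s zs where ys: "w = (ys @ [s]) @ zs" "walk (insert e E) (ys @ [s])"
        "hd (ys @ [s]) = hd w" "s \<in> {a, b}" "set ys \<inter> {a, b} = {}"
        using walk_first_hit[OF w(1,3)] by metis
      have "walk E (ys @ [s])"
        using walk_insert_edge_avoiding ys e by metis
      then show ?thesis
        using ys w(2) by (intro bexI[of _ s] exI[of _ "ys @ [s]"]) auto
    qed
    obtain x p where x: "x \<in> {a, b}" and p: "walk E p" "hd p \<in> A" "last p = x" "set p \<inter> S = {}"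
      using first_end[of w] w hit unfolding link_def by metis
    obtain y q where y: "y \<in> {a, b}" and q: "walk E q" "hd q \<in> B" "last q = y" "set q \<inter> S = {}"
      using first_end[of "rev w"] w hit unfolding link_def walk_rev hd_rev set_rev by metis
    have no_join: False if r: "walk E r" "hd r \<in> A" "set r \<inter> S = {}"
      and r': "walk E r'" "hd r' \<in> B" "set r' \<inter> S = {}" "last r = last r'" for r r'
    proof -
      have q': "walk E (rev r')" "last r = hd (rev r')" "last (rev r') = hd r'"
        using r' by (auto simp: walk_rev hd_rev last_rev)
      note j = walk_join[OF r(1) q'(1,2)]
      have "link E A B (r @ tl (rev r'))"
        using j r r' q' by (auto simp: link_def)
      from sep[OF this] show False
        unfolding j(4) using r r' by auto
    qed
    have "x \<noteq> y"
      using no_join[of p q] p q by auto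
    then have e': "e = {x, y}" "e = {y, x}"
      using x y e by auto
    have xS: "x \<notin> S" "y \<notin> S"
      using p q by (auto simp: walk_def dest!: last_in_set)
    have ny: "set r \<inter> S \<noteq> {}" if "link E A {y} r" for r
      using no_join[of r q] that q by (auto simp: link_def)
    have nx: "set r \<inter> S \<noteq> {}" if "link E B {x} r" for r
      using no_join[of p r] that p by (auto simp: link_def)
    have "\<exists>xs. link E A (insert x S) xs \<and> set xs \<inter> T = {}" if "finite T" "card T < k" for T
      using insert.prems(4)[OF that] separator_insert_endpoint[OF sep ny] e'(1) by blast
    then obtain P where P: "card P = k" "pairwise (\<lambda>p q. set p \<inter> set q = {}) P"
      "\<And>p. p \<in> P \<Longrightarrow> link E A (insert x S) p"
      using insert.IH[of A "insert x S"] cE finA S(1) by auto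
    have "\<exists>xs. link E B (insert y S) xs \<and> set xs \<inter> T = {}" if T: "finite T" "card T < k" for T
    proof -
      obtain xs where "link (insert e E) B A xs" "set xs \<inter> T = {}"
        using insert.prems(4)[OF T] by (metis link_rev set_rev)
      then show ?thesis
        using separator_insert_endpoint[OF sep' nx] e'(2) by blast
    qed
    then obtain Q where Q: "card Q = k" "pairwise (\<lambda>p q. set p \<inter> set q = {}) Q"
      "\<And>p. p \<in> Q \<Longrightarrow> link E B (insert y S) p"
      using insert.IH[of B "insert y S"] cE finB S(1) by auto
    have le: "card (insert x S) \<le> card P" "card (insert y S) \<le> card Q"
      using S P Q xS by auto
    obtain g where g: "card (insert x S) = card P"
      "\<And>s. s \<in> insert x S \<Longrightarrow>
        walk E (g s) \<and> hd (g s) \<in> A \<and> last (g s) = s \<and> set (butlast (g s)) \<inter> insert x S = {}"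
      "\<And>s t. s \<in> insert x S \<Longrightarrow> t \<in> insert x S \<Longrightarrow> s \<noteq> t \<Longrightarrow> set (g s) \<inter> set (g t) = {}"
      using linkage_onto[OF P(2,3) _ le(1)] S(1) by (metis finite_insert)
    obtain h where h: "card (insert y S) = card Q"
      "\<And>s. s \<in> insert y S \<Longrightarrow>
        walk E (h s) \<and> hd (h s) \<in> B \<and> last (h s) = s \<and> set (butlast (h s)) \<inter> insert y S = {}"
      "\<And>s t. s \<in> insert y S \<Longrightarrow> t \<in> insert y S \<Longrightarrow> s \<noteq> t \<Longrightarrow> set (h s) \<inter> set (h t) = {}"
      using linkage_onto[OF Q(2,3) _ le(2)] S(1) by (metis finite_insert)
    \<comment> \<open>The separator was assumed smaller than \<open>k\<close>; the linkage onto
      \<open>insert x S\<close> shows that it falls short by exactly one, which the path through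
      \<open>e\<close> makes up for.\<close>
    have "Suc (card S) = k"
      using g(1) P(1) S(1) xS by auto
    then show ?thesis
      using combine_linkages[OF sep S(1) xS g(2,3) h(2,3)] e'(1) by auto
  qed
qed

section \<open>Finite trees\<close>

lemma induced_subgraph_verts [simp]: "verts (induced_subgraph G X) = X"
  by (simp add: induced_subgraph_def)

lemma edges_induced_subgraph: "edges (induced_subgraph G X) = {e \<in> edges G. e \<subseteq> X}"
  by (simp add: induced_subgraph_def)

lemma conn_induced_subgraph: "Y \<subseteq> X \<Longrightarrow> conn (edges (induced_subgraph G X)) Y \<longleftrightarrow> conn (edges G) Y"
  by (rule conn_cong) (auto simp: edges_induced_subgraph)

lemma simple_graph_induced_subgraph:
  "simple_graph G \<Longrightarrow> X \<subseteq> verts G \<Longrightarrow> simple_graph (induced_subgraph G X)"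
  by (auto simp: simple_graph_def edges_induced_subgraph intro: finite_subset)

lemma induced_subgraph_self: "simple_graph G \<Longrightarrow> induced_subgraph G (verts G) = G"
  by (cases G) (auto simp: simple_graph_def induced_subgraph_def)

text \<open>A cycle of an induced subgraph is a cycle of \<open>T\<close>, so connectivity is all
  that has to be checked.\<close>

lemma tree_graph_induced_subgraph_iff:
  assumes "tree_graph T" "N \<subseteq> verts T"
  shows "tree_graph (induced_subgraph T N) \<longleftrightarrow> conn (edges T) N"
proof -
  have s: "simple_graph (induced_subgraph T N)"
    using assms simple_graph_induced_subgraph by (auto simp: tree_graph_def)
  have "\<not> cycle_in (induced_subgraph T N) c" for c
    using assms by (auto simp: tree_graph_def cycle_in_def edges_induced_subgraph)
  then show ?thesis
    using s by (simp add: tree_graph_def connected_graph_iff_conn conn_induced_subgraph)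
qed

lemma no_loop: "simple_graph G \<Longrightarrow> {v, w} \<in> edges G \<Longrightarrow> v \<noteq> w"
  by (auto simp: simple_graph_def)

lemma conn_remove_leaf:
  assumes leaf: "\<And>q. {l, q} \<in> E \<Longrightarrow> q = p" and "p \<noteq> l" and X: "conn E X" "X - {l} \<noteq> {}"
  shows "conn E (X - {l})"
proof -
  obtain r where r: "r \<in> X" "r \<noteq> l"
    using X by auto
  \<comment> \<open>A path through the leaf enters and leaves it by way of \<open>p\<close>.
    Projecting \<open>l\<close> to \<open>p\<close> turns such a detour into a stationary step and
    gives an invariant that avoids \<open>l\<close>.\<close>
  have *: "(r, if v = l then p else v) \<in> (adj_in E (X - {l}))\<^sup>*" if "(r, v) \<in> (adj_in E X)\<^sup>*" for v
    using that
  proof (induction rule: rtrancl_induct)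
    case base
    then show ?case using r by simp
  next
    case (step v z)
    have vz: "v \<in> X" "z \<in> X" "{v, z} \<in> E"
      using step.hyps by (auto simp: adj_in_def)
    consider "v = l" | "v \<noteq> l" "z = l" | "v \<noteq> l" "z \<noteq> l"
      by auto
    then show ?case
    proof cases
      case 1
      then have "z = p" using vz leaf by blast
      then show ?thesis using 1 step.IH \<open>p \<noteq> l\<close> by simp
    next
      case 2
      then have "{l, v} \<in> E"
        using vz by (simp add: insert_commute)
      then have "v = p" using leaf by blast
      then show ?thesis using 2 step.IH by simp
    next
      case 3
      then have "(v, z) \<in> adj_in E (X - {l})"
        using vz by (simp add: adj_in_def)
      then show ?thesis using 3 step.IH by simp
    qed
  qed
  show ?thesis
  proof (rule connI_root)
    show "r \<in> X - {l}" using r by simp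
    show "(r, v) \<in> (adj_in E (X - {l}))\<^sup>*" if "v \<in> X - {l}" for v
      using *[of v] that X(1) r(1) by (simp add: conn_def)
  qed
qed

lemma conn_has_neighbour:
  assumes "conn E X" "u \<in> X" "v \<in> X" "u \<noteq> v"
  obtains w where "w \<in> X" "{u, w} \<in> E"
proof -
  have "(u, v) \<in> (adj_in E X)\<^sup>*"
    using assms by (simp add: conn_def)
  then show ?thesis
    using assms(4) that by (cases rule: converse_rtranclE) (auto simp: adj_in_def)
qed

lemma cycle_in_closed_walk:
  assumes "walk (edges G) xs" "distinct xs" "3 \<le> length xs" "{last xs, hd xs} \<in> edges G"
  shows "cycle_in G xs"
  unfolding cycle_in_def
proof (intro conjI allI impI)
  fix i assume i: "i < length xs"
  show "{xs ! i, xs ! (Suc i mod length xs)} \<in> edges G"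
  proof (cases "Suc i < length xs")
    case True
    then show ?thesis
      using assms(1) by (auto simp: walk_def successively_conv_nth)
  next
    case False
    then have "Suc i = length xs"
      using i by simp
    then have "length xs - 1 = i" "Suc i mod length xs = 0" "xs \<noteq> []"
      using i by auto
    then have "xs ! i = last xs" "xs ! (Suc i mod length xs) = hd xs"
      by (simp_all add: last_conv_nth hd_conv_nth)
    then show ?thesis
      using assms(4) by simp
  qed
qed (use assms in auto)

text \<open>The first vertex of a longest path is a leaf: a further neighbour would either extend
  the path or close a cycle with it.\<close>

lemma tree_has_leaf:
  assumes T: "tree_graph T" and two: "u \<in> verts T" "v \<in> verts T" "u \<noteq> v"
  obtains l p where "l \<in> verts T" "{l, p} \<in> edges T" "\<And>q. {l, q} \<in> edges T \<Longrightarrow> q = p"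
proof -
  have simple: "simple_graph T" and fin: "finite (verts T)" and co: "conn (edges T) (verts T)"
    and acyc: "\<And>c. \<not> cycle_in T c"
    using T connected_graph_iff_conn by (auto simp: tree_graph_def simple_graph_def)
  obtain w where w: "w \<in> verts T" "{u, w} \<in> edges T"
    by (rule conn_has_neighbour[OF co two])
  define Q where "Q = (\<lambda>xs. walk (edges T) xs \<and> distinct xs \<and> set xs \<subseteq> verts T)"
  have "u \<noteq> w"
    using no_loop[OF simple w(2)] .
  then have Quw: "Q [u, w]"
    using w two by (simp add: Q_def walk_Cons)
  have "\<forall>xs. Q xs \<longrightarrow> length xs < Suc (card (verts T))"
    unfolding Q_def less_Suc_eq_le using card_mono[OF fin] distinct_card by metis
  with Quw have "\<exists>xs. Q xs \<and> (\<forall>ys. Q ys \<longrightarrow> length ys \<le> length xs)"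
    by (rule ex_has_greatest_nat)
  then obtain xs where xs: "Q xs" "\<And>ys. Q ys \<Longrightarrow> length ys \<le> length xs"
    by blast
  have "2 \<le> length xs"
    using xs(2)[OF Quw] by simp
  then obtain x y zs where xyz: "xs = x # y # zs"
    by (cases xs; cases "tl xs") auto
  show ?thesis
  proof (rule that[of x y])
    show "x \<in> verts T" "{x, y} \<in> edges T"
      using xs(1) by (auto simp: xyz Q_def walk_Cons)
    fix q assume q: "{x, q} \<in> edges T"
    show "q = y"
    proof (rule ccontr)
      assume "q \<noteq> y"
      have "q \<noteq> x" using no_loop[OF simple q] by simp
      have "q \<in> set xs"
      proof (rule ccontr)
        assume "q \<notin> set xs"
        then have "Q (q # xs)"
          using xs(1) q simple by (auto simp: Q_def walk_Cons xyz insert_commute simple_graph_def)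
        then show False
          using xs(2) by fastforce
      qed
      then have "q \<in> set zs"
        using \<open>q \<noteq> y\<close> \<open>q \<noteq> x\<close> by (simp add: xyz)
      then obtain as bs where zs: "zs = as @ q # bs"
        by (meson split_list)
      have "walk (edges T) ((x # y # as @ [q]) @ bs)" "distinct ((x # y # as @ [q]) @ bs)"
        using xs(1) by (auto simp: Q_def xyz zs)
      then have "walk (edges T) (x # y # as @ [q])" "distinct (x # y # as @ [q])"
        by (simp_all only: walk_append distinct_append split: if_splits) auto
      then have "cycle_in T (x # y # as @ [q])"
        using q by (intro cycle_in_closed_walk) (auto simp: insert_commute)
      then show False
        using acyc by simp
    qed
  qed
qed

lemma tree_remove_leaf:
  assumes "tree_graph T" "\<And>q. {l, q} \<in> edges T \<Longrightarrow> q = p" "p \<noteq> l" "verts T - {l} \<noteq> {}"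
  shows "tree_graph (induced_subgraph T (verts T - {l}))"
proof -
  have "conn (edges T) (verts T)"
    using assms(1) connected_graph_iff_conn by (auto simp: tree_graph_def)
  from conn_remove_leaf[OF assms(2,3) this assms(4)] show ?thesis
    by (subst tree_graph_induced_subgraph_iff[OF assms(1)]) auto
qed

text \<open>Induction by deleting a leaf \<open>l\<close> with neighbour \<open>p\<close>. If some
  member is just \<open>{l}\<close>, then \<open>l\<close> lies in all members. Otherwise every
  member containing \<open>l\<close> also contains \<open>p\<close>, so members that met in
  \<open>l\<close> still meet in \<open>p\<close> after the deletion.\<close>

theorem helly_subtrees:
  assumes "tree_graph T"
    "\<And>i. i \<in> M \<Longrightarrow> N i \<subseteq> verts T \<and> conn (edges T) (N i)"
    "\<And>i j. i \<in> M \<Longrightarrow> j \<in> M \<Longrightarrow> N i \<inter> N j \<noteq> {}"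
  shows "\<exists>t \<in> verts T. \<forall>i \<in> M. t \<in> N i"
  using assms
proof (induction "card (verts T)" arbitrary: T N rule: less_induct)
  case less
  note T = less.prems(1) and N = less.prems(2) and meet = less.prems(3)
  have simple: "simple_graph T" and fin: "finite (verts T)"
    and ne: "verts T \<noteq> {}"
    using T by (auto simp: tree_graph_def simple_graph_def connected_graph_def)
  show ?case
  proof (cases "\<exists>u \<in> verts T. \<exists>v \<in> verts T. u \<noteq> v")
    case False
    then obtain u where u: "verts T = {u}"
      using ne by auto
    have "u \<in> N i" if "i \<in> M" for i
      using N[OF that] u by (auto simp: conn_def)
    then show ?thesis
      using u by auto
  next
    case True
    then obtain l p where l: "l \<in> verts T" "{l, p} \<in> edges T" and leaf: "\<And>q. {l, q} \<in> edges T \<Longrightarrow> q = p"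
      using True by (meson T tree_has_leaf)
    have "p \<noteq> l"
      using no_loop[OF simple l(2)] by simp
    have "p \<in> verts T"
      using l(2) simple by (auto simp: simple_graph_def)
    define T' where "T' = induced_subgraph T (verts T - {l})"
    have T': "tree_graph T'"
      unfolding T'_def using \<open>p \<in> verts T\<close> \<open>p \<noteq> l\<close> by (intro tree_remove_leaf[OF T leaf]) auto
    show ?thesis
    proof (cases "\<exists>i\<in>M. N i \<subseteq> {l}")
      case True
      then obtain i where i: "i \<in> M" "N i \<subseteq> {l}" by auto
      have "l \<in> N j" if "j \<in> M" for j
        using meet[OF i(1) that] i(2) by auto
      then show ?thesis
        using l(1) by auto
    next
      case False
      have p_in: "p \<in> N i" if "i \<in> M" "l \<in> N i" for i
      proof -
        obtain v where "v \<in> N i" "v \<noteq> l"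
          using False \<open>i \<in> M\<close> by auto
        moreover have "conn (edges T) (N i)"
          using N that by blast
        ultimately obtain w where "w \<in> N i" "{l, w} \<in> edges T"
          using \<open>l \<in> N i\<close> by (metis conn_has_neighbour)
        then show ?thesis
          using leaf[of w] by auto
      qed
      have "\<exists>t \<in> verts T'. \<forall>i \<in> M. t \<in> N i - {l}"
      proof (rule less.hyps)
        have "verts T' \<subset> verts T"
          using l(1) by (auto simp: T'_def)
        then show "card (verts T') < card (verts T)"
          using fin by (rule psubset_card_mono[rotated])
        show "tree_graph T'" by fact
        show "N i - {l} \<subseteq> verts T' \<and> conn (edges T') (N i - {l})" if "i \<in> M" for i
        proof
          show sub: "N i - {l} \<subseteq> verts T'"
            using N[OF that] by (auto simp: T'_def)
          have "conn (edges T) (N i - {l})"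
            using N[OF that] False that by (intro conn_remove_leaf[OF leaf \<open>p \<noteq> l\<close>]) auto
          then show "conn (edges T') (N i - {l})"
            using sub unfolding T'_def by (subst conn_induced_subgraph) auto
        qed
        show "(N i - {l}) \<inter> (N j - {l}) \<noteq> {}" if ij: "i \<in> M" "j \<in> M" for i j
        proof -
          obtain t where "t \<in> N i" "t \<in> N j"
            using meet[OF ij] by auto
          then show ?thesis
            using p_in[OF ij(1)] p_in[OF ij(2)] \<open>p \<noteq> l\<close> by (cases "t = l") auto
        qed
      qed
      then show ?thesis
        by (auto simp: T'_def)
    qed
  qed
qed

section \<open>Tree decompositions\<close>

text \<open>The subtrees of two adjacent vertices share the node whose bag contains the edge;
  chaining this along paths inside \<open>X\<close> connects the union of the subtrees. It serves
  both the bramble argument and the transfer of decompositions to intersection graphs.\<close>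

lemma tree_decomposition_node_set_conn:
  assumes td: "tree_decomposition G T \<beta>" and X: "conn (edges G) X" "X \<subseteq> verts G"
  shows "conn (edges T) {t \<in> verts T. \<beta> t \<inter> X \<noteq> {}}"
proof -
  define N where "N = (\<lambda>v. {t \<in> verts T. v \<in> \<beta> t})"
  define M where "M = {t \<in> verts T. \<beta> t \<inter> X \<noteq> {}}"
  have T: "tree_graph T" and edge: "\<And>e. e \<in> edges G \<Longrightarrow> \<exists>t\<in>verts T. e \<subseteq> \<beta> t"
    using td by (auto simp: tree_decomposition_def)
  have N: "conn (edges T) (N v)" if "v \<in> verts G" for v
    using td that tree_graph_induced_subgraph_iff[OF T, of "N v"]
    by (auto simp: tree_decomposition_def N_def)
  have NM: "N v \<subseteq> M" if "v \<in> X" for v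
    using that by (auto simp: N_def M_def)
  have within: "(s, t) \<in> (adj_in (edges T) M)\<^sup>*" if "v \<in> X" "s \<in> N v" "t \<in> N v" for v s t
    using N[of v] NM[of v] X(2) that by (meson conn_def order_refl rtrancl_adj_in_mono subsetD)
  have across: "\<forall>s\<in>N u. \<forall>t\<in>N v. (s, t) \<in> (adj_in (edges T) M)\<^sup>*"
    if "(u, v) \<in> (adj_in (edges G) X)\<^sup>*" "u \<in> X" for u v
    using that
  proof (induction rule: rtrancl_induct)
    case base
    then show ?case using within by blast
  next
    case (step v w)
    then have vw: "v \<in> X" "w \<in> X" "{v, w} \<in> edges G"
      by (auto simp: adj_in_def)
    then obtain r where r: "r \<in> N v" "r \<in> N w"
      using edge[of "{v, w}"] by (auto simp: N_def)
    show ?case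
      using step.IH step.prems r within[OF vw(2) r(2)] by (meson rtrancl_trans)
  qed
  obtain x where x: "x \<in> X"
    using X by (auto simp: conn_def)
  then obtain r where r: "r \<in> N x"
    using N[of x] X by (auto simp: conn_def)
  have "conn (edges T) M"
  proof (rule connI_root)
    show "r \<in> M" using r NM[OF x] by auto
    fix t assume "t \<in> M"
    then obtain y where "y \<in> X" "t \<in> N y"
      by (auto simp: M_def N_def)
    then show "(r, t) \<in> (adj_in (edges T) M)\<^sup>*"
      using across[of x y] x r X(1) by (auto simp: conn_def)
  qed
  then show ?thesis
    by (simp add: M_def)
qed

text \<open>The easy half of the bramble duality, for pairwise intersecting members: the nodes whose
  bags meet a given member form a subtree, these subtrees pairwise meet, and the Helly property
  yields one node for all members.\<close>

lemma bag_meeting_intersecting_family: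
  assumes td: "tree_decomposition G T \<beta>"
    and X: "\<And>i. i \<in> M \<Longrightarrow> conn (edges G) (X i) \<and> X i \<subseteq> verts G"
    and meet: "\<And>i j. i \<in> M \<Longrightarrow> j \<in> M \<Longrightarrow> X i \<inter> X j \<noteq> {}"
  shows "\<exists>t \<in> verts T. \<forall>i \<in> M. \<beta> t \<inter> X i \<noteq> {}"
proof -
  define N where "N = (\<lambda>i. {t \<in> verts T. \<beta> t \<inter> X i \<noteq> {}})"
  have "\<exists>t \<in> verts T. \<forall>i \<in> M. t \<in> N i"
  proof (rule helly_subtrees)
    show "tree_graph T" using td by (simp add: tree_decomposition_def)
    show "N i \<subseteq> verts T \<and> conn (edges T) (N i)" if "i \<in> M" for i
      using tree_decomposition_node_set_conn[OF td] X[OF that] by (auto simp: N_def)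
    show "N i \<inter> N j \<noteq> {}" if ij: "i \<in> M" "j \<in> M" for i j
    proof -
      obtain v where v: "v \<in> X i" "v \<in> X j" using meet[OF ij] by auto
      then obtain t where "t \<in> verts T" "v \<in> \<beta> t"
        using td X[OF ij(1)] unfolding tree_decomposition_def by blast
      then show ?thesis using v by (auto simp: N_def)
    qed
  qed
  then show ?thesis by (simp add: N_def)
qed

section \<open>Bounds on the invariants as existence of suitable decompositions\<close>

lemma trivial_tree_decomposition:
  assumes "simple_graph G"
  shows "tree_decomposition G \<lparr>verts = {0 :: nat}, edges = {}\<rparr> (\<lambda>_. verts G)"
proof -
  have "tree_graph \<lparr>verts = {0 :: nat}, edges = {}\<rparr>"
    by (auto simp: tree_graph_def simple_graph_def connected_graph_def cycle_in_def)
       (metis length_greater_0_conv list.size(3) not_numeral_le_zero)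
  then show ?thesis
    using assms by (auto simp: tree_decomposition_def simple_graph_def induced_subgraph_def)
qed

lemma finite_verts_tree: "tree_graph T \<Longrightarrow> finite (verts T) \<and> verts T \<noteq> {}"
  by (auto simp: tree_graph_def simple_graph_def connected_graph_def)

lemma td_width_le_iff:
  assumes "tree_graph T"
  shows "td_width T \<beta> \<le> w \<longleftrightarrow> (\<forall>t \<in> verts T. int (card (\<beta> t)) \<le> w + 1)"
proof -
  define C where "C = (\<lambda>t. card (\<beta> t)) ` verts T"
  have C: "finite C" "C \<noteq> {}"
    using finite_verts_tree[OF assms] by (auto simp: C_def)
  have "td_width T \<beta> \<le> w \<longleftrightarrow> int (Max C) \<le> w + 1"
    by (auto simp: td_width_def C_def)
  also have "\<dots> \<longleftrightarrow> (\<forall>c \<in> C. int c \<le> w + 1)"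
    using Max_in[OF C] Max_ge[OF C(1)] by (meson of_nat_mono order_trans)
  finally show ?thesis
    by (auto simp: C_def)
qed

text \<open>The \<open>LEAST\<close> in the definition ranges over integers, which are not
  well-ordered. Every width has the form \<open>int n - 1\<close>, so the minimum is taken over the
  naturals \<open>n\<close>, and the one-bag decomposition shows that it exists.\<close>

lemma treewidth_le_iff:
  assumes "simple_graph G"
  shows "treewidth G \<le> w \<longleftrightarrow>
    (\<exists>(T :: nat sgraph) \<beta>. tree_decomposition G T \<beta> \<and> (\<forall>t \<in> verts T. int (card (\<beta> t)) \<le> w + 1))"
proof -
  define P where "P = (\<lambda>w. \<exists>(T :: nat sgraph) \<beta>. tree_decomposition G T \<beta> \<and> w = td_width T \<beta>)"
  define n where "n = (LEAST n :: nat. P (int n - 1))"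
  have width: "\<exists>n. td_width T \<beta> = int n - 1" for T :: "nat sgraph" and \<beta> :: "nat \<Rightarrow> 'a set"
    by (auto simp: td_width_def)
  have "\<exists>n :: nat. P (int n - 1)"
    using trivial_tree_decomposition[OF assms] width unfolding P_def by metis
  then have n: "P (int n - 1)"
    unfolding n_def by (rule LeastI_ex)
  have least: "int n - 1 \<le> y" if y: "P y" for y
  proof -
    obtain m where "y = int m - 1"
      using y width unfolding P_def by metis
    then show ?thesis
      using Least_le[of "\<lambda>n. P (int n - 1)" m] y by (simp add: n_def)
  qed
  have "treewidth G = int n - 1"
    unfolding treewidth_def P_def[symmetric] using n least by (rule Least_equality[of P])
  then have "treewidth G \<le> w \<longleftrightarrow> (\<exists>y \<le> w. P y)"
    using n least by (auto intro: order_trans)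
  also have "\<dots> \<longleftrightarrow> (\<exists>(T :: nat sgraph) \<beta>. tree_decomposition G T \<beta> \<and> td_width T \<beta> \<le> w)"
    unfolding P_def by blast
  also have "\<dots> \<longleftrightarrow> (\<exists>(T :: nat sgraph) \<beta>. tree_decomposition G T \<beta> \<and>
      (\<forall>t \<in> verts T. int (card (\<beta> t)) \<le> w + 1))"
    by (intro ex_cong1 conj_cong refl td_width_le_iff) (simp add: tree_decomposition_def)
  finally show ?thesis .
qed

lemma independent_in_finite: "simple_graph G \<Longrightarrow> finite {S. independent_in G S} \<and> {} \<in> {S. independent_in G S}"
  by (auto simp: simple_graph_def independent_in_def intro: finite_subset[of _ "Pow (verts G)"])

lemma clique_in_finite: "simple_graph G \<Longrightarrow> finite {S. clique_in G S} \<and> {} \<in> {S. clique_in G S}"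
  by (auto simp: simple_graph_def clique_in_def intro: finite_subset[of _ "Pow (verts G)"])

lemma independence_number_le_iff:
  assumes "simple_graph G"
  shows "independence_number G \<le> k \<longleftrightarrow> (\<forall>S. independent_in G S \<longrightarrow> card S \<le> k)"
  unfolding independence_number_def using independent_in_finite[OF assms]
  by (subst Max_le_iff) auto

lemma clique_number_le_iff:
  assumes "simple_graph G"
  shows "clique_number G \<le> k \<longleftrightarrow> (\<forall>S. clique_in G S \<longrightarrow> card S \<le> k)"
  unfolding clique_number_def using clique_in_finite[OF assms]
  by (subst Max_le_iff) auto

lemma tree_independence_number_le_iff:
  assumes G: "simple_graph G"
  shows "tree_independence_number G \<le> k \<longleftrightarrow>
    (\<exists>(T :: nat sgraph) \<beta>. tree_decomposition G T \<beta> \<and>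
      (\<forall>t \<in> verts T. \<forall>S \<subseteq> \<beta> t. independent_in G S \<longrightarrow> card S \<le> k))"
proof -
  define P where "P = (\<lambda>k. \<exists>(T :: nat sgraph) \<beta>. tree_decomposition G T \<beta> \<and> k = td_independence G T \<beta>)"
  have "\<exists>k. P k"
    using trivial_tree_decomposition[OF G] unfolding P_def by blast
  then have "tree_independence_number G \<le> k \<longleftrightarrow> (\<exists>j \<le> k. P j)"
    unfolding tree_independence_number_def P_def[symmetric]
    by (meson LeastI_ex Least_le order_trans)
  also have "\<dots> \<longleftrightarrow> (\<exists>(T :: nat sgraph) \<beta>. tree_decomposition G T \<beta> \<and> td_independence G T \<beta> \<le> k)"
    unfolding P_def by blast
  also have "\<dots> \<longleftrightarrow> (\<exists>(T :: nat sgraph) \<beta>. tree_decomposition G T \<beta> \<and>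
      (\<forall>t \<in> verts T. \<forall>S \<subseteq> \<beta> t. independent_in G S \<longrightarrow> card S \<le> k))"
  proof -
    have "td_independence G T \<beta> \<le> k \<longleftrightarrow>
        (\<forall>t \<in> verts T. \<forall>S \<subseteq> \<beta> t. independent_in G S \<longrightarrow> card S \<le> k)"
      if td: "tree_decomposition G T \<beta>" for T :: "nat sgraph" and \<beta>
    proof -
      have T: "finite (verts T)" "verts T \<noteq> {}" and \<beta>: "\<And>t. t \<in> verts T \<Longrightarrow> \<beta> t \<subseteq> verts G"
        using td finite_verts_tree by (auto simp: tree_decomposition_def)
      have "independent_in (induced_subgraph G X) S \<longleftrightarrow> S \<subseteq> X \<and> independent_in G S"
        if "X \<subseteq> verts G" for X S
        using that unfolding independent_in_def edges_induced_subgraph induced_subgraph_verts by blast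
      then have "independence_number (induced_subgraph G (\<beta> t)) \<le> k \<longleftrightarrow>
          (\<forall>S \<subseteq> \<beta> t. independent_in G S \<longrightarrow> card S \<le> k)" if "t \<in> verts T" for t
        using independence_number_le_iff simple_graph_induced_subgraph[OF G] \<beta>[OF that] by metis
      then show ?thesis
        unfolding td_independence_def using T by (subst Max_le_iff) auto
    qed
    then show ?thesis
      by (intro ex_cong1 conj_cong refl)
  qed
  finally show ?thesis .
qed

section \<open>Tree decompositions from balanced separators\<close>

text \<open>Nodes are \<open>0, \<dots>, n - 1\<close>, the root is \<open>0\<close> and \<open>p i < i\<close> is the parent of \<open>i > 0\<close>; the nodes
  containing a given vertex are connected because exactly one of them is topmost.\<close>

definition rooted_decomposition ::
    "'a set set \<Rightarrow> nat \<Rightarrow> 'a set \<Rightarrow> 'a set \<Rightarrow> nat \<Rightarrow> (nat \<Rightarrow> nat) \<Rightarrow> (nat \<Rightarrow> 'a set) \<Rightarrow> bool" where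
  "rooted_decomposition E w U W n p \<beta> \<longleftrightarrow>
     0 < n \<and> (\<forall>i. 0 < i \<longrightarrow> i < n \<longrightarrow> p i < i) \<and>
     (\<forall>i < n. \<beta> i \<subseteq> U \<and> card (\<beta> i) \<le> w) \<and>
     (\<forall>e \<in> E. e \<subseteq> U \<longrightarrow> (\<exists>i < n. e \<subseteq> \<beta> i)) \<and>
     (\<forall>v \<in> U. \<exists>!i. i < n \<and> v \<in> \<beta> i \<and> (i = 0 \<or> v \<notin> \<beta> (p i))) \<and>
     W \<subseteq> \<beta> 0"

definition decomposable :: "'a set set \<Rightarrow> nat \<Rightarrow> 'a set \<Rightarrow> 'a set \<Rightarrow> bool" where
  "decomposable E w U W \<longleftrightarrow> (\<exists>n p \<beta>. rooted_decomposition E w U W n p \<beta>)"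

definition parent_graph :: "nat \<Rightarrow> (nat \<Rightarrow> nat) \<Rightarrow> nat sgraph" where
  "parent_graph n p = \<lparr>verts = {..<n}, edges = {{i, p i} | i. 0 < i \<and> i < n}\<rparr>"

lemma simple_parent_graph:
  assumes "\<And>i. 0 < i \<Longrightarrow> i < n \<Longrightarrow> p i < i"
  shows "simple_graph (parent_graph n p)"
  unfolding simple_graph_def
proof (intro conjI ballI)
  fix e assume "e \<in> edges (parent_graph n p)"
  then obtain i where i: "0 < i" "i < n" "e = {i, p i}"
    by (auto simp: parent_graph_def)
  then show "e \<subseteq> verts (parent_graph n p)" "card e = 2"
    using assms[OF i(1,2)] by (auto simp: parent_graph_def card_2_iff)
qed (simp add: parent_graph_def)

text \<open>Moving to the parent as long as it stays in \<open>A\<close> ends in a topmost node of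
  \<open>A\<close>. If there is only one such node, all of \<open>A\<close> is connected to
  it.\<close>

lemma conn_parent_graph:
  assumes p: "\<And>i. 0 < i \<Longrightarrow> i < n \<Longrightarrow> p i < i" and A: "A \<subseteq> {..<n}"
    and top: "\<exists>!i. i \<in> A \<and> (i = 0 \<or> p i \<notin> A)"
  shows "conn (edges (parent_graph n p)) A"
proof -
  obtain r where r: "r \<in> A" "\<And>i. i \<in> A \<Longrightarrow> i = 0 \<or> p i \<notin> A \<Longrightarrow> i = r"
    using top by blast
  show ?thesis
  proof (rule connI_root[OF r(1)])
    fix v assume "v \<in> A"
    then show "(r, v) \<in> (adj_in (edges (parent_graph n p)) A)\<^sup>*"
    proof (induction v rule: less_induct)
      case (less v)
      show ?case
      proof (cases "v = 0 \<or> p v \<notin> A")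
        case True
        then show ?thesis using r(2)[OF less.prems] by simp
      next
        case False
        then have "p v < v" "p v \<in> A" "0 < v" "v < n"
          using p[of v] A less.prems by auto
        moreover from this have "(p v, v) \<in> adj_in (edges (parent_graph n p)) A"
          using less.prems by (auto simp: adj_in_def parent_graph_def insert_commute)
        ultimately show ?thesis
          using less.IH by (meson rtrancl.rtrancl_into_rtrancl)
      qed
    qed
  qed
qed

lemma tree_parent_graph:
  assumes p: "\<And>i. 0 < i \<Longrightarrow> i < n \<Longrightarrow> p i < i" and "0 < n"
  shows "tree_graph (parent_graph n p)"
proof -
  have simple: "simple_graph (parent_graph n p)"
    using simple_parent_graph p by blast
  have "conn (edges (parent_graph n p)) {..<n}"
  proof (rule conn_parent_graph[OF p])
    have "p i < n" if "i < n" "i \<noteq> 0" for i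
      using p[of i] that by auto
    then show "\<exists>!i. i \<in> {..<n} \<and> (i = 0 \<or> p i \<notin> {..<n})"
      using \<open>0 < n\<close> by auto
  qed auto
  moreover have "\<not> cycle_in (parent_graph n p) c" for c
  proof
    assume c: "cycle_in (parent_graph n p) c"
    define l where "l = length c"
    have l: "3 \<le> l" "distinct c"
      and edge: "\<And>i. i < l \<Longrightarrow> {c ! i, c ! (Suc i mod l)} \<in> edges (parent_graph n p)"
      using c by (auto simp: cycle_in_def l_def)
    \<comment> \<open>Both cycle neighbours of the greatest node are at most \<open>m\<close>, and
      an edge from \<open>m\<close> to such a node can only lead to its parent. So the two
      neighbours coincide, which is impossible in a cycle of length at least 3.\<close>
    define m where "m = Max (set c)"
    have "m \<in> set c" and max: "\<And>x. x \<in> set c \<Longrightarrow> x \<le> m"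
      using l by (auto simp: m_def l_def intro!: Max_in)
    then obtain i where i: "i < l" "c ! i = m"
      by (auto simp: in_set_conv_nth l_def)
    have par: "x = p m" if mx: "{m, x} \<in> edges (parent_graph n p)" "x \<in> set c" for x
    proof -
      obtain j where j: "0 < j" "j < n" "{m, x} = {j, p j}"
        using mx by (auto simp: parent_graph_def)
      have "p j < j" "x \<le> m"
        using p[OF j(1,2)] max mx by auto
      then show ?thesis
        using j(3) by (auto simp: doubleton_eq_iff)
    qed
    define s where "s = Suc i mod l"
    define q where "q = (if i = 0 then l - 1 else i - 1)"
    have sq: "s < l" "q < l" "Suc q mod l = i" "s \<noteq> q"
      using i l by (auto simp: s_def q_def mod_Suc)
    have "c ! s = p m"
      using edge[OF i(1)] i sq by (intro par) (auto simp: s_def l_def)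
    moreover have "c ! q = p m"
      using edge[OF sq(2)] i sq by (intro par) (auto simp: l_def insert_commute)
    ultimately show False
      using sq l by (metis l_def nth_eq_iff_index_eq)
  qed
  ultimately show ?thesis
    using simple by (simp add: tree_graph_def connected_graph_iff_conn parent_graph_def)
qed

lemma treewidth_le_of_decomposable:
  assumes G: "simple_graph G" and dec: "decomposable (edges G) (Suc w) (verts G) W"
  shows "treewidth G \<le> int w"
proof -
  obtain n p \<beta> where "rooted_decomposition (edges G) (Suc w) (verts G) W n p \<beta>"
    using dec by (auto simp: decomposable_def)
  then have n: "0 < n" and p: "\<And>i. 0 < i \<Longrightarrow> i < n \<Longrightarrow> p i < i"
    and bag: "\<And>i. i < n \<Longrightarrow> \<beta> i \<subseteq> verts G \<and> card (\<beta> i) \<le> Suc w"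
    and edge: "\<And>e. e \<in> edges G \<Longrightarrow> e \<subseteq> verts G \<Longrightarrow> \<exists>i < n. e \<subseteq> \<beta> i"
    and top: "\<And>v. v \<in> verts G \<Longrightarrow> \<exists>!i. i < n \<and> v \<in> \<beta> i \<and> (i = 0 \<or> v \<notin> \<beta> (p i))"
    by (auto simp: rooted_decomposition_def)
  define T where "T = parent_graph n p"
  have T: "tree_graph T" and VT: "verts T = {..<n}"
    using tree_parent_graph[OF p n] by (auto simp: T_def parent_graph_def)
  have vertex: "tree_graph (induced_subgraph T {t \<in> verts T. v \<in> \<beta> t}) \<and> (\<exists>t\<in>verts T. v \<in> \<beta> t)"
    if v: "v \<in> verts G" for v
  proof -
    define A where "A = {t. t < n \<and> v \<in> \<beta> t}"
    have A_iff: "i \<in> A \<and> (i = 0 \<or> p i \<notin> A) \<longleftrightarrow> i < n \<and> v \<in> \<beta> i \<and> (i = 0 \<or> v \<notin> \<beta> (p i))" for i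
      using p[of i] by (auto simp: A_def)
    have "conn (edges T) A"
      unfolding T_def
    proof (rule conn_parent_graph[OF p])
      show "\<exists>!i. i \<in> A \<and> (i = 0 \<or> p i \<notin> A)"
        unfolding A_iff by (rule top[OF v])
    qed (auto simp: A_def)
    moreover have "A = {t \<in> verts T. v \<in> \<beta> t}"
      by (auto simp: A_def VT)
    ultimately have "tree_graph (induced_subgraph T {t \<in> verts T. v \<in> \<beta> t})"
      using tree_graph_induced_subgraph_iff[OF T] by auto
    then show ?thesis
      using top[OF v] VT by blast
  qed
  have "\<exists>t\<in>verts T. e \<subseteq> \<beta> t" if "e \<in> edges G" for e
    using edge[OF that] G that VT by (auto simp: simple_graph_def)
  then have "tree_decomposition G T \<beta>"
    unfolding tree_decomposition_def using T vertex bag VT by blast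
  moreover have "\<forall>t\<in>verts T. int (card (\<beta> t)) \<le> int w + 1"
    using bag VT by fastforce
  ultimately show ?thesis
    using treewidth_le_iff[OF G] by blast
qed

lemma decomposable_single_bag:
  assumes "card U \<le> w" "W \<subseteq> U"
  shows "decomposable E w U W"
  unfolding decomposable_def rooted_decomposition_def
  using assms by (intro exI[of _ "1 :: nat"] exI[of _ "\<lambda>_. 0"] exI[of _ "\<lambda>_. U"]) auto

text \<open>The nodes of the second tree are shifted by \<open>n1\<close> and its root becomes a
  child of the first root. A vertex of both sides lies in both root bags, so it loses its topmost
  node in the second tree and keeps the one in the first; this preserves uniqueness.\<close>

lemma decomposable_glue:
  assumes d1: "decomposable E w U1 W1" and d2: "decomposable E w U2 W2"
    and int: "U1 \<inter> U2 \<subseteq> W1 \<inter> W2"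
    and edges: "\<And>e. e \<in> E \<Longrightarrow> e \<subseteq> U1 \<union> U2 \<Longrightarrow> e \<subseteq> U1 \<or> e \<subseteq> U2"
  shows "decomposable E w (U1 \<union> U2) W1"
proof -
  obtain n1 p1 b1 where r1: "rooted_decomposition E w U1 W1 n1 p1 b1"
    using d1 by (auto simp: decomposable_def)
  obtain n2 p2 b2 where r2: "rooted_decomposition E w U2 W2 n2 p2 b2"
    using d2 by (auto simp: decomposable_def)
  have n: "0 < n1" "0 < n2"
    and p1: "\<And>i. 0 < i \<Longrightarrow> i < n1 \<Longrightarrow> p1 i < i" and p2: "\<And>i. 0 < i \<Longrightarrow> i < n2 \<Longrightarrow> p2 i < i"
    and b1: "\<And>i. i < n1 \<Longrightarrow> b1 i \<subseteq> U1 \<and> card (b1 i) \<le> w"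
    and b2: "\<And>i. i < n2 \<Longrightarrow> b2 i \<subseteq> U2 \<and> card (b2 i) \<le> w"
    and e1: "\<And>e. e \<in> E \<Longrightarrow> e \<subseteq> U1 \<Longrightarrow> \<exists>i < n1. e \<subseteq> b1 i"
    and e2: "\<And>e. e \<in> E \<Longrightarrow> e \<subseteq> U2 \<Longrightarrow> \<exists>i < n2. e \<subseteq> b2 i"
    and t1: "\<And>v. v \<in> U1 \<Longrightarrow> \<exists>!i. i < n1 \<and> v \<in> b1 i \<and> (i = 0 \<or> v \<notin> b1 (p1 i))"
    and t2: "\<And>v. v \<in> U2 \<Longrightarrow> \<exists>!i. i < n2 \<and> v \<in> b2 i \<and> (i = 0 \<or> v \<notin> b2 (p2 i))"
    and W: "W1 \<subseteq> b1 0" "W2 \<subseteq> b2 0"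
    using r1 r2 by (simp_all add: rooted_decomposition_def)
  define p where "p = (\<lambda>i. if i < n1 then p1 i else if i = n1 then 0 else n1 + p2 (i - n1))"
  define b where "b = (\<lambda>i. if i < n1 then b1 i else b2 (i - n1))"
  define top where "top = (\<lambda>v i. v \<in> b i \<and> (i = 0 \<or> v \<notin> b (p i)))"
  have top1: "top v i \<longleftrightarrow> v \<in> b1 i \<and> (i = 0 \<or> v \<notin> b1 (p1 i))" if "i < n1" for v i
    using that p1[of i] by (auto simp: top_def b_def p_def)
  have top2: "top v (n1 + i) \<longleftrightarrow> v \<in> b2 i \<and> (if i = 0 then v \<notin> b1 0 else v \<notin> b2 (p2 i))" if "i < n2" for v i
    using that n by (auto simp: top_def b_def p_def)
  have tops: "\<exists>!i. i < n1 + n2 \<and> top v i" if v: "v \<in> U1 \<union> U2" for v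
  proof (cases "v \<in> U1")
    case True
    obtain i where i: "i < n1" "top v i" and uniq: "\<And>j. j < n1 \<Longrightarrow> top v j \<Longrightarrow> j = i"
      using t1[OF True] top1 by metis
    \<comment> \<open>The unique topmost node of a shared \<open>v\<close> in the second tree is its
      root, which now has a parent whose bag contains \<open>v\<close>.\<close>
    have no2: False if j: "j < n2" "top v (n1 + j)" for j
    proof -
      have "v \<in> b2 j"
        using top2 j by blast
      then have "v \<in> U2" using b2[OF j(1)] by blast
      then have v0: "v \<in> b1 0" "v \<in> b2 0"
        using int True W by auto
      then have "j \<noteq> 0" "v \<notin> b2 (p2 j)"
        using top2[OF j(1)] j(2) by (auto split: if_splits)
      then show False
        using t2[OF \<open>v \<in> U2\<close>] \<open>v \<in> b2 j\<close> v0(2) j(1) n(2) by metis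
    qed
    show ?thesis
    proof (rule ex1I[of _ i])
      show "i < n1 + n2 \<and> top v i" using i by simp
      fix j assume j: "j < n1 + n2 \<and> top v j"
      have "j < n1"
      proof (rule ccontr)
        assume "\<not> j < n1"
        then show False
          using no2[of "j - n1"] j by (simp add: not_less) linarith
      qed
      then show "j = i" using uniq j by simp
    qed
  next
    case False
    then have "v \<in> U2" using v by simp
    have not1: "v \<notin> b1 i" if "i < n1" for i
      using b1[OF that] False by blast
    obtain i where i: "i < n2" "v \<in> b2 i" "i = 0 \<or> v \<notin> b2 (p2 i)"
      and uniq: "\<And>j. j < n2 \<Longrightarrow> v \<in> b2 j \<Longrightarrow> j = 0 \<or> v \<notin> b2 (p2 j) \<Longrightarrow> j = i"
      using t2[OF \<open>v \<in> U2\<close>] by metis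
    show ?thesis
    proof (rule ex1I[of _ "n1 + i"])
      show "n1 + i < n1 + n2 \<and> top v (n1 + i)"
        using i top2[OF i(1), of v] not1[OF n(1)] by auto
      fix j assume j: "j < n1 + n2 \<and> top v j"
      have "n1 \<le> j"
        using j top1 not1 by (meson not_le)
      then obtain k where k: "j = n1 + k" "k < n2"
        using j by (metis add_less_cancel_left le_Suc_ex)
      then have "v \<in> b2 k \<and> (k = 0 \<or> v \<notin> b2 (p2 k))"
        using j top2[OF k(2)] by (auto split: if_splits)
      then show "j = n1 + i"
        using uniq k by auto
    qed
  qed
  have "rooted_decomposition E w (U1 \<union> U2) W1 (n1 + n2) p b"
    unfolding rooted_decomposition_def
  proof (intro conjI allI impI ballI)
    show "0 < n1 + n2" using n by simp
    show "W1 \<subseteq> b 0" using W n by (simp add: b_def)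
    fix i assume i: "i < n1 + n2"
    then have i': "i - n1 < n2"
      using n by linarith
    show "b i \<subseteq> U1 \<union> U2" "card (b i) \<le> w"
      using b1[of i] b2[OF i'] by (auto simp: b_def)
    assume "0 < i"
    moreover have "n1 + p2 (i - n1) < i" if "n1 < i"
      using p2[of "i - n1"] i' that by linarith
    ultimately show "p i < i"
      using p1[of i] by (auto simp: p_def)
  next
    fix e assume e: "e \<in> E" "e \<subseteq> U1 \<union> U2"
    then consider i where "i < n1" "e \<subseteq> b1 i" | i where "i < n2" "e \<subseteq> b2 i"
      using edges[OF e] e1[OF e(1)] e2[OF e(1)] by blast
    then show "\<exists>i<n1 + n2. e \<subseteq> b i"
    proof cases
      case 1
      then show ?thesis by (intro exI[of _ i]) (simp add: b_def)
    next
      case 2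
      then show ?thesis by (intro exI[of _ "n1 + i"]) (simp add: b_def)
    qed
  next
    fix v assume "v \<in> U1 \<union> U2"
    then show "\<exists>!i. i < n1 + n2 \<and> v \<in> b i \<and> (i = 0 \<or> v \<notin> b (p i))"
      using tops unfolding top_def by simp
  qed
  then show ?thesis
    by (auto simp: decomposable_def)
qed

text \<open>The classical recursion. Enlarge \<open>W\<close> to a set \<open>W'\<close> of
  \<open>2 * k + 1\<close> vertices and take a balanced separator \<open>S\<close> for it. Each
  component \<open>C\<close> of \<open>U - S\<close> has at most \<open>k\<close> vertices in
  \<open>W'\<close>, so \<open>C \<union> S\<close> can be decomposed recursively with the at most
  \<open>2 * k\<close> vertices of \<open>(C \<inter> W') \<union> S\<close> in its root bag. These
  decompositions are hung below the bag \<open>W' \<union> S\<close>, which has at most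
  \<open>3 * k + 1\<close> vertices.\<close>

lemma decomposable_if_balanced_separators:
  assumes sep: "\<And>W. W \<subseteq> V \<Longrightarrow> card W = 2 * k + 1 \<Longrightarrow>
      \<exists>S. finite S \<and> card S \<le> k \<and> (\<forall>X \<subseteq> V. conn E X \<longrightarrow> X \<inter> S = {} \<longrightarrow> card (X \<inter> W) \<le> k)"
    and E: "\<And>e. e \<in> E \<Longrightarrow> card e = 2"
    and "finite U" "U \<subseteq> V" "W \<subseteq> U" "card W \<le> 2 * k + 1"
  shows "decomposable E (3 * k + 1) U W"
  using assms(3-)
proof (induction "card U" arbitrary: U W rule: less_induct)
  case less
  note fin = \<open>finite U\<close>
  show ?case
  proof (cases "card U \<le> 3 * k + 1")
    case True
    then show ?thesis
      using less.prems by (intro decomposable_single_bag)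
  next
    case False
    obtain W' where W': "W \<subseteq> W'" "W' \<subseteq> U" "card W' = 2 * k + 1"
      using exists_subset_between[of W "2 * k + 1" U] less.prems False by auto
    obtain S0 where S0: "finite S0" "card S0 \<le> k"
      and small: "\<And>X. X \<subseteq> V \<Longrightarrow> conn E X \<Longrightarrow> X \<inter> S0 = {} \<Longrightarrow> card (X \<inter> W') \<le> k"
      using sep[of W'] W' less.prems by (metis order_trans)
    \<comment> \<open>The separator may contain vertices outside \<open>U\<close>; a subset of
      \<open>U - S\<close> still avoids all of \<open>S0\<close>.\<close>
    define S where "S = S0 \<inter> U"
    have S: "finite S" "card S \<le> k" "S \<subseteq> U"
      using S0 card_mono[of S0 S] by (auto simp: S_def)
    define R where "R = (adj_in E (U - S))\<^sup>*"
    define comp where "comp = (\<lambda>v. {u. (v, u) \<in> R})"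
    have comp_sub: "comp v \<subseteq> U - S" if "v \<in> U - S" for v
      unfolding comp_def R_def using that rtrancl_adj_in_closed by fast
    have comp_eq: "comp u = comp v" if "u \<in> comp v" for u v
      using that unfolding comp_def R_def
      by (auto intro: rtrancl_trans dest: rtrancl_adj_in_sym)
    have comp_edge: "b \<in> comp v" if "v \<in> U - S" "a \<in> comp v" "{a, b} \<in> E" "b \<in> U - S" for a b v
    proof -
      have "(a, b) \<in> adj_in E (U - S)"
        using comp_sub[OF that(1)] that by (auto simp: adj_in_def)
      then show ?thesis
        using that(2) unfolding comp_def R_def by (auto intro: rtrancl_into_rtrancl)
    qed
    have comp_conn: "conn E (comp v)" if v: "v \<in> U - S" for v
    proof (rule connI_root)
      show "v \<in> comp v" by (simp add: comp_def R_def)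
      show "(v, u) \<in> (adj_in E (comp v))\<^sup>*" if "u \<in> comp v" for u
      proof -
        have "(v, u) \<in> (adj_in E (U - S))\<^sup>*"
          using that by (simp add: comp_def R_def)
        then show ?thesis
        proof (induction rule: rtrancl_induct)
          case (step y z)
          have "y \<in> comp v" "z \<in> comp v"
            using step.hyps by (auto simp: comp_def R_def)
          then have "(y, z) \<in> adj_in E (comp v)"
            using step.hyps by (auto simp: adj_in_def)
          then show ?case
            using step.IH by (rule rtrancl_into_rtrancl[rotated])
        qed simp
      qed
    qed
    have small_comp: "card (comp v \<inter> W') \<le> k" if "v \<in> U - S" for v
      using small[of "comp v"] comp_conn[OF that] comp_sub[OF that] less.prems by (auto simp: S_def)
    have part: "decomposable E (3 * k + 1) (comp v \<union> S) ((comp v \<inter> W') \<union> S)" if v: "v \<in> U - S" for v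
    proof (rule less.hyps)
      have "card ((comp v \<inter> W') \<union> S) \<le> 2 * k"
        using small_comp[OF v] S card_Un_le[of "comp v \<inter> W'" S] by linarith
      then show "card ((comp v \<inter> W') \<union> S) \<le> 2 * k + 1" by simp
      \<comment> \<open>Since \<open>2 * k < card W'\<close>, some vertex of \<open>W'\<close> lies
        outside \<open>comp v \<union> S\<close>; this makes the recursive call smaller.\<close>
      have "\<not> W' \<subseteq> (comp v \<inter> W') \<union> S"
      proof
        assume "W' \<subseteq> (comp v \<inter> W') \<union> S"
        moreover have "finite ((comp v \<inter> W') \<union> S)"
          using S fin W' by (auto intro: finite_subset)
        ultimately have "card W' \<le> card ((comp v \<inter> W') \<union> S)"
          by (rule card_mono[rotated])
        then show False
          using \<open>card ((comp v \<inter> W') \<union> S) \<le> 2 * k\<close> W'(3) by simp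
      qed
      then have "comp v \<union> S \<subset> U"
        using comp_sub[OF v] S(3) W'(2) by blast
      then show "card (comp v \<union> S) < card U"
        using fin by (rule psubset_card_mono[rotated])
      show "finite (comp v \<union> S)" "comp v \<union> S \<subseteq> V"
        using comp_sub[OF v] S fin less.prems by (auto intro: finite_subset)
    qed auto
    \<comment> \<open>The components are glued on one at a time, represented by their vertices; a
      vertex of a component already present changes nothing.\<close>
    have glue: "decomposable E (3 * k + 1) (W' \<union> S \<union> \<Union> (comp ` Q)) (W' \<union> S)"
      if "finite Q" "Q \<subseteq> U - S" for Q
      using that
    proof (induction Q rule: finite_induct)
      case empty
      have "card (W' \<union> S) \<le> 3 * k + 1"
        using card_Un_le[of W' S] W' S by linarith
      then show ?case
        by (intro decomposable_single_bag) auto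
    next
      case (insert v Q)
      show ?case
      proof (cases "v \<in> \<Union> (comp ` Q)")
        case True
        then have "comp v \<subseteq> \<Union> (comp ` Q)"
          using comp_eq by blast
        then have "\<Union> (comp ` insert v Q) = \<Union> (comp ` Q)"
          by auto
        then show ?thesis
          using insert by simp
      next
        case False
        have v: "v \<in> U - S" using insert.prems by simp
        have disj: "comp v \<inter> \<Union> (comp ` Q) = {}"
        proof (rule ccontr)
          assume "comp v \<inter> \<Union> (comp ` Q) \<noteq> {}"
          then obtain x q where "x \<in> comp v" "q \<in> Q" "x \<in> comp q" by auto
          then have "comp v = comp q" using comp_eq by metis
          then show False
            using False \<open>q \<in> Q\<close> by (auto simp: comp_def R_def)
        qed
        have "decomposable E (3 * k + 1) ((W' \<union> S \<union> \<Union> (comp ` Q)) \<union> (comp v \<union> S)) (W' \<union> S)"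
        proof (rule decomposable_glue)
          show "decomposable E (3 * k + 1) (W' \<union> S \<union> \<Union> (comp ` Q)) (W' \<union> S)"
            using insert by simp
          show "decomposable E (3 * k + 1) (comp v \<union> S) ((comp v \<inter> W') \<union> S)"
            by (rule part[OF v])
          show "(W' \<union> S \<union> \<Union> (comp ` Q)) \<inter> (comp v \<union> S) \<subseteq> (W' \<union> S) \<inter> ((comp v \<inter> W') \<union> S)"
            using disj by blast
          fix e assume e: "e \<in> E" "e \<subseteq> (W' \<union> S \<union> \<Union> (comp ` Q)) \<union> (comp v \<union> S)"
          have sub: "(W' \<union> S \<union> \<Union> (comp ` Q)) \<union> (comp v \<union> S) \<subseteq> U"
            using W' S comp_sub insert.prems by blast
          obtain a b where ab: "e = {a, b}"
            using E[OF e(1)] by (auto simp: card_2_iff)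
          show "e \<subseteq> W' \<union> S \<union> \<Union> (comp ` Q) \<or> e \<subseteq> comp v \<union> S"
          proof (cases "a \<in> comp v \<or> b \<in> comp v")
            case True
            then have "e \<subseteq> comp v \<union> S"
              using comp_edge[OF v, of a b] comp_edge[OF v, of b a] e ab sub
              by (auto simp: insert_commute)
            then show ?thesis by simp
          next
            case False
            then show ?thesis using e ab by auto
          qed
        qed
        moreover have "(W' \<union> S \<union> \<Union> (comp ` Q)) \<union> (comp v \<union> S) = W' \<union> S \<union> \<Union> (comp ` insert v Q)"
          by auto
        ultimately show ?thesis by simp
      qed
    qed
    have "W' \<union> S \<union> \<Union> (comp ` (U - S)) = U"
    proof
      show "W' \<union> S \<union> \<Union> (comp ` (U - S)) \<subseteq> U"
        using W' S comp_sub by blast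
      have "v \<in> comp v" for v
        by (simp add: comp_def R_def)
      then show "U \<subseteq> W' \<union> S \<union> \<Union> (comp ` (U - S))"
        by blast
    qed
    then have "decomposable E (3 * k + 1) U (W' \<union> S)"
      using glue[of "U - S"] fin by simp
    then obtain n p \<beta> where "rooted_decomposition E (3 * k + 1) U (W' \<union> S) n p \<beta>"
      by (auto simp: decomposable_def)
    moreover from this have "W' \<union> S \<subseteq> \<beta> 0"
      unfolding rooted_decomposition_def by (elim conjE)
    then have "W \<subseteq> \<beta> 0"
      using W'(1) by blast
    ultimately have "rooted_decomposition E (3 * k + 1) U W n p \<beta>"
      unfolding rooted_decomposition_def by (elim conjE) (intro conjI)
    then show ?thesis
      by (auto simp: decomposable_def)
  qed
qed

section \<open>Brambles, paths and disjoint segments\<close>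

text \<open>The invariant is a path that meets some member \<open>X\<close> in its last vertex only.
  If a member \<open>Y\<close> is missed, the path is prolonged inside \<open>X\<close>, towards a
  vertex of \<open>X \<inter> Y\<close>, up to its first vertex in \<open>Y\<close>. The new piece
  lies in \<open>X\<close>, so it is disjoint from the old path, and \<open>Y\<close> takes over the
  role of \<open>X\<close>.\<close>

lemma intersecting_family_path:
  assumes fin: "finite V" and ne: "\<B> \<noteq> {}"
    and B: "\<And>X. X \<in> \<B> \<Longrightarrow> conn E X \<and> X \<subseteq> V"
    and meet: "\<And>X Y. X \<in> \<B> \<Longrightarrow> Y \<in> \<B> \<Longrightarrow> X \<inter> Y \<noteq> {}"
  shows "\<exists>xs. walk E xs \<and> distinct xs \<and> set xs \<subseteq> V \<and> (\<forall>X\<in>\<B>. X \<inter> set xs \<noteq> {})"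
proof -
  have finB: "finite \<B>"
    using B fin by (auto intro: finite_subset[of _ "Pow V"])
  have ext: "\<exists>ys. walk E ys \<and> distinct ys \<and> set ys \<subseteq> V \<and> (\<forall>X\<in>\<B>. X \<inter> set ys \<noteq> {})"
    if "walk E xs" "distinct xs" "set xs \<subseteq> V" "X \<in> \<B>" "X \<inter> set xs = {last xs}" for xs X
    using that
  proof (induction "card {X \<in> \<B>. X \<inter> set xs = {}}" arbitrary: xs X rule: less_induct)
    case less
    show ?case
    proof (cases "\<forall>Y\<in>\<B>. Y \<inter> set xs \<noteq> {}")
      case True
      then show ?thesis using less.prems by blast
    next
      case False
      then obtain Y where Y: "Y \<in> \<B>" "Y \<inter> set xs = {}" by auto
      obtain u where u: "u \<in> X" "u \<in> Y"
        using meet less.prems(4) Y(1) by blast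
      have X: "conn E X" "X \<subseteq> V" "last xs \<in> X"
        using B less.prems by auto
      obtain zs where zs: "walk E zs" "distinct zs" "hd zs = last xs" "last zs = u" "set zs \<subseteq> X"
        using conn_walk_exists[OF X(1,3) u(1)] by blast
      have "u \<in> set zs"
        using zs(1,4) by (auto simp: walk_def)
      then have "set zs \<inter> Y \<noteq> {}"
        using u by auto
      then obtain ys s rest where ys: "zs = (ys @ [s]) @ rest" "walk E (ys @ [s])"
        "hd (ys @ [s]) = hd zs" "s \<in> Y" "set ys \<inter> Y = {}"
        by (rule walk_first_hit[OF zs(1)])
      define q where "q = ys @ [s]"
      have "xs \<noteq> []" using less.prems by (simp add: walk_def)
      then have "last xs \<notin> Y" using Y by auto
      then have "ys \<noteq> []"
        using ys zs by auto
      have q: "walk E q" "last xs = hd q" "last q = s" "distinct q" "set q \<subseteq> X"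
        using ys zs by (auto simp: q_def)
      note j = walk_join[OF less.prems(1) q(1,2)]
      have q_cons: "q = hd q # tl q"
        using q(1) by (simp add: walk_def)
      have tl_disj: "set (tl q) \<inter> set xs = {}"
      proof -
        have "hd q \<notin> set (tl q)"
          using q(4) q_cons by (metis distinct.simps(2))
        moreover have "set (tl q) \<subseteq> X"
          using q(5) q_cons by (metis set_subset_Cons subset_trans)
        ultimately have "x \<in> X \<inter> set xs \<and> x \<noteq> last xs" if "x \<in> set (tl q) \<inter> set xs" for x
          using that q(2) by auto
        then show ?thesis
          using less.prems(5) by blast
      qed
      define xs' where "xs' = xs @ tl q"
      have set': "set xs' = set xs \<union> set q" and last': "last xs' = s" and walk': "walk E xs'"
        using j q(3) by (auto simp: xs'_def)
      have "distinct (tl q)"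
        using q(4) by (rule distinct_tl)
      then have "distinct xs'"
        using tl_disj less.prems(2) by (auto simp: xs'_def)
      moreover have "Y \<inter> set xs' = {last xs'}"
        using Y ys unfolding set' last' q_def by auto
      moreover have "set xs' \<subseteq> V"
        using q(5) X(2) less.prems(3) unfolding set' by blast
      moreover have "{X \<in> \<B>. X \<inter> set xs' = {}} \<subset> {X \<in> \<B>. X \<inter> set xs = {}}"
        using Y ys(4) unfolding set' q_def by auto
      then have "card {X \<in> \<B>. X \<inter> set xs' = {}} < card {X \<in> \<B>. X \<inter> set xs = {}}"
        using finB by (intro psubset_card_mono) auto
      ultimately show ?thesis
        using less.hyps walk' Y(1) by blast
    qed
  qed
  obtain X where X: "X \<in> \<B>" using ne by auto
  then obtain v where v: "v \<in> X"
    using B[OF X] unfolding conn_def by blast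
  show ?thesis
    using ext[of "[v]" X] X v B by auto
qed

text \<open>In bramble terminology this says that \<open>\<B>\<close> has order at least \<open>k\<close>.\<close>

definition cover_number_ge :: "nat \<Rightarrow> 'a set set \<Rightarrow> bool" where
  "cover_number_ge k \<B> \<longleftrightarrow> (\<forall>S. finite S \<longrightarrow> card S < k \<longrightarrow> (\<exists>X \<in> \<B>. X \<inter> S = {}))"

text \<open>The first segment is the shortest prefix that meets a subfamily of cover number at least
  \<open>k\<close>. By minimality this subfamily has a cover of size at most \<open>k\<close>, so
  the members missing the prefix retain cover number at least \<open>m * k\<close> out of
  \<open>Suc m * k\<close>, and they all meet the rest of the path. The rest may be empty, hence
  \<open>successively\<close> in place of \<open>walk\<close>.\<close>

lemma cut_path_into_segments:
  assumes "0 < k" "successively (\<lambda>x y. {x, y} \<in> E) xs" "distinct xs"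
    and "\<And>X. X \<in> \<B> \<Longrightarrow> X \<inter> set xs \<noteq> {}" "cover_number_ge (m * k) \<B>"
  shows "\<exists>P :: nat \<Rightarrow> 'a set. (\<forall>i < m. P i \<subseteq> set xs \<and> conn E (P i) \<and>
      cover_number_ge k {X \<in> \<B>. X \<inter> P i \<noteq> {}}) \<and>
    (\<forall>i < m. \<forall>j < m. i \<noteq> j \<longrightarrow> P i \<inter> P j = {})"
  using assms(2-)
proof (induction m arbitrary: xs \<B>)
  case 0
  then show ?case by simp
next
  case (Suc m)
  define Bt where "Bt = (\<lambda>n. {X \<in> \<B>. X \<inter> set (take n xs) \<noteq> {}})"
  define n where "n = (LEAST n. cover_number_ge k (Bt n))"
  have "Bt (length xs) = \<B>"
    using Suc.prems(3) by (auto simp: Bt_def)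
  moreover have "cover_number_ge k \<B>"
    using Suc.prems(4) by (auto simp: cover_number_ge_def)
  ultimately have ex: "cover_number_ge k (Bt (length xs))"
    by simp
  then have n: "cover_number_ge k (Bt n)" and n_le: "n \<le> length xs"
    unfolding n_def by (rule LeastI, rule Least_le)
  \<comment> \<open>As \<open>k\<close> is positive, the empty prefix does not suffice, so the
    chosen prefix has a last vertex \<open>xs ! n'\<close>.\<close>
  have "\<not> cover_number_ge k (Bt 0)"
    using assms(1) by (auto simp: cover_number_ge_def Bt_def intro!: exI[of _ "{}"])
  then obtain n' where n': "n = Suc n'"
    using n by (cases n) auto
  then have "\<not> cover_number_ge k (Bt n')"
    unfolding n_def using not_less_Least[of n' "\<lambda>n. cover_number_ge k (Bt n)"] by (simp add: n_def)
  then obtain S where S: "finite S" "card S < k" "\<And>X. X \<in> Bt n' \<Longrightarrow> X \<inter> S \<noteq> {}"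
    by (auto simp: cover_number_ge_def)
  \<comment> \<open>Members met by the prefix are met by the prefix without its last vertex, and
    then covered by \<open>S\<close>, or they contain the last vertex.\<close>
  define S' where "S' = insert (xs ! n') S"
  have take: "take n xs = take n' xs @ [xs ! n']"
    using n_le n' by (simp add: take_Suc_conv_app_nth)
  have S': "finite S'" "card S' \<le> k" "\<And>X. X \<in> Bt n \<Longrightarrow> X \<inter> S' \<noteq> {}"
  proof -
    show "finite S'" "card S' \<le> k"
      using S card_insert_le_m1[of k S "xs ! n'"] assms(1) by (auto simp: S'_def card_insert_if)
    fix X assume "X \<in> Bt n"
    then show "X \<inter> S' \<noteq> {}"
      using S(3)[of X] unfolding Bt_def take S'_def by auto
  qed
  define \<B>' where "\<B>' = \<B> - Bt n"
  have split: "take n xs @ drop n xs = xs"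
    by simp
  have succ: "successively (\<lambda>x y. {x, y} \<in> E) (take n xs)" "successively (\<lambda>x y. {x, y} \<in> E) (drop n xs)"
    using Suc.prems(1) split by (metis successively_append_iff)+
  have disj: "set (take n xs) \<inter> set (drop n xs) = {}" and sets: "set (take n xs) \<union> set (drop n xs) = set xs"
    using Suc.prems(2) split by (metis distinct_append, metis set_append)
  have "\<exists>P :: nat \<Rightarrow> 'a set. (\<forall>i < m. P i \<subseteq> set (drop n xs) \<and> conn E (P i) \<and>
      cover_number_ge k {X \<in> \<B>'. X \<inter> P i \<noteq> {}}) \<and>
    (\<forall>i < m. \<forall>j < m. i \<noteq> j \<longrightarrow> P i \<inter> P j = {})"
  proof (rule Suc.IH)
    show "successively (\<lambda>x y. {x, y} \<in> E) (drop n xs)" by (rule succ)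
    show "distinct (drop n xs)" using Suc.prems(2) by simp
    show "X \<inter> set (drop n xs) \<noteq> {}" if "X \<in> \<B>'" for X
      using Suc.prems(3)[of X] that sets by (auto simp: \<B>'_def Bt_def)
    show "cover_number_ge (m * k) \<B>'"
      unfolding cover_number_ge_def
    proof (intro allI impI)
      fix R :: "'a set" assume R: "finite R" "card R < m * k"
      have "card (R \<union> S') < Suc m * k"
        using card_Un_le[of R S'] R S' by simp
      then obtain X where X: "X \<in> \<B>" "X \<inter> (R \<union> S') = {}"
        using Suc.prems(4) R S' unfolding cover_number_ge_def by (meson finite_UnI)
      then have "X \<notin> Bt n"
        using S'(3)[of X] by auto
      then show "\<exists>X\<in>\<B>'. X \<inter> R = {}"
        using X by (auto simp: \<B>'_def)
    qed
  qed
  then obtain P :: "nat \<Rightarrow> 'a set" where P0: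
    "\<forall>i < m. P i \<subseteq> set (drop n xs) \<and> conn E (P i) \<and> cover_number_ge k {X \<in> \<B>'. X \<inter> P i \<noteq> {}}"
    "\<forall>i < m. \<forall>j < m. i \<noteq> j \<longrightarrow> P i \<inter> P j = {}"
    by (elim exE conjE)
  have P: "P i \<subseteq> set (drop n xs) \<and> conn E (P i) \<and> cover_number_ge k {X \<in> \<B>'. X \<inter> P i \<noteq> {}}"
    "j < m \<Longrightarrow> i \<noteq> j \<Longrightarrow> P i \<inter> P j = {}" if "i < m" for i j
    using P0(1)[rule_format, OF that] P0(2)[rule_format, OF that] by simp_all
  have cov_mono: "cover_number_ge k \<C>'" if "cover_number_ge k \<C>" "\<C> \<subseteq> \<C>'" for \<C> \<C>' :: "'a set set"
    using that unfolding cover_number_ge_def by blast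
  define Q where "Q = (\<lambda>i. case i of 0 \<Rightarrow> set (take n xs) | Suc i \<Rightarrow> P i)"
  have "walk E (take n xs)"
    using succ(1) n' n_le by (auto simp: walk_def)
  then have Q0: "Q 0 \<subseteq> set xs \<and> conn E (Q 0) \<and> cover_number_ge k {X \<in> \<B>. X \<inter> Q 0 \<noteq> {}}"
    using conn_walk n set_take_subset[of n xs] by (simp add: Q_def Bt_def)
  have QS: "Q (Suc i) \<subseteq> set xs \<and> conn E (Q (Suc i)) \<and> cover_number_ge k {X \<in> \<B>. X \<inter> Q (Suc i) \<noteq> {}}"
    if "i < m" for i
  proof -
    have "cover_number_ge k {X \<in> \<B>. X \<inter> P i \<noteq> {}}"
      by (rule cov_mono[of "{X \<in> \<B>'. X \<inter> P i \<noteq> {}}"]) (use P(1)[OF that] in \<open>auto simp: \<B>'_def\<close>)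
    then show ?thesis
      using P(1)[OF that] set_drop_subset[of n xs] by (simp add: Q_def) blast
  qed
  have Q0S: "Q 0 \<inter> Q (Suc i) = {}" if "i < m" for i
    using P(1)[OF that] disj unfolding Q_def by auto
  have QD: "Q i \<inter> Q j = {}" if "i < Suc m" "j < Suc m" "i \<noteq> j" for i j
    using that Q0S P(2) by (cases i; cases j) (simp_all add: Int_commute, simp add: Q_def)
  show ?case
  proof (intro exI[of _ Q] conjI allI impI)
    fix i assume "i < Suc m"
    then show "Q i \<subseteq> set xs" "conn E (Q i)" "cover_number_ge k {X \<in> \<B>. X \<inter> Q i \<noteq> {}}"
      using Q0 QS by (cases i; auto)+
  qed (use QD in auto)
qed

section \<open>Disjoint representatives\<close>

text \<open>The size needed for a greedy choice from \<open>Suc N\<close> families: more than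
  \<open>N * c\<close> elements, so that one survives the exclusion of up to \<open>c\<close>
  elements for each other family, and \<open>c * selection_bound c N + c\<close> elements for the
  contradiction that limits these exclusions to \<open>c\<close>.\<close>

primrec selection_bound :: "nat \<Rightarrow> nat \<Rightarrow> nat" where
  "selection_bound c 0 = 0"
| "selection_bound c (Suc N) = Suc (c * selection_bound c N + c + N * c)"

text \<open>A representative \<open>x\<close> of one family is fixed such that at least
  \<open>K\<close> elements of every other family are unrelated to \<open>x\<close>, and the
  induction continues with these. The hypothesis on subfamilies of size \<open>c\<close> ensures
  that few elements are unsuitable as \<open>x\<close>.\<close>

lemma select_unrelated:
  assumes "finite I"
    and "\<And>a. a \<in> I \<Longrightarrow> finite (F a) \<and> selection_bound c (card I) \<le> card (F a)"
    and "\<And>x y. R x y \<Longrightarrow> R y x"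
    and "\<And>a b A B. a \<in> I \<Longrightarrow> b \<in> I \<Longrightarrow> a \<noteq> b \<Longrightarrow> A \<subseteq> F a \<Longrightarrow> B \<subseteq> F b \<Longrightarrow>
      card A = c \<Longrightarrow> card B = c \<Longrightarrow> \<exists>x \<in> A. \<exists>y \<in> B. \<not> R x y"
  shows "\<exists>q. (\<forall>a \<in> I. q a \<in> F a) \<and> (\<forall>a \<in> I. \<forall>b \<in> I. a \<noteq> b \<longrightarrow> \<not> R (q a) (q b))"
  using assms(1,2,4)
proof (induction I arbitrary: F rule: finite_induct)
  case empty
  then show ?case by simp
next
  case (insert z I F)
  define K where "K = selection_bound c (card I)"
  have card_I: "card (insert z I) = Suc (card I)"
    using insert.hyps by simp
  have F: "finite (F a)" "c * K + c + card I * c < card (F a)" if "a \<in> insert z I" for a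
    using insert.prems(1)[OF that] unfolding card_I K_def by auto
  define bad where "bad = (\<lambda>a. {x \<in> F z. card {y \<in> F a. \<not> R x y} < K})"
  have bad: "card (bad a) \<le> c" if a: "a \<in> I" for a
  proof (rule ccontr)
    assume "\<not> card (bad a) \<le> c"
    then obtain A where A: "A \<subseteq> bad a" "card A = c" "finite A"
      by (meson nat_le_linear obtain_subset_with_card_n)
    \<comment> \<open>Every element of \<open>F a - D\<close> is related to all of \<open>A\<close>.
      As \<open>D\<close> has at most \<open>c * K\<close> elements, \<open>c\<close> elements
      remain, forming with \<open>A\<close> a forbidden pair of completely related sets.\<close>
    define D where "D = (\<Union>x\<in>A. {y \<in> F a. \<not> R x y})"
    have "card D \<le> (\<Sum>x\<in>A. card {y \<in> F a. \<not> R x y})"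
      unfolding D_def using A(3) by (rule card_UN_le)
    also have "\<dots> \<le> (\<Sum>x\<in>A. K)"
      using A(1) by (intro sum_mono) (auto simp: bad_def)
    finally have "card D \<le> c * K"
      using A(2) by simp
    then have "c \<le> card (F a) - card D"
      using F[of a] a by simp
    also have "\<dots> = card (F a - D)"
      using F[of a] a by (intro card_Diff_subset[symmetric]) (auto simp: D_def intro: finite_subset)
    finally obtain B where B: "B \<subseteq> F a - D" "card B = c"
      by (meson obtain_subset_with_card_n)
    have "\<exists>x \<in> A. \<exists>y \<in> B. \<not> R x y"
      using A B a insert.hyps by (intro insert.prems(2)[of z a]) (auto simp: bad_def)
    then show False
      using B A by (auto simp: D_def)
  qed
  have "card (\<Union>a\<in>I. bad a) \<le> (\<Sum>a\<in>I. card (bad a))"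
    using insert.hyps by (intro card_UN_le)
  also have "\<dots> \<le> (\<Sum>a\<in>I. c)"
    using bad by (intro sum_mono) auto
  finally have "card (\<Union>a\<in>I. bad a) < card (F z)"
    using F[of z] by simp
  then obtain x where x: "x \<in> F z" "x \<notin> (\<Union>a\<in>I. bad a)"
    by (metis (mono_tags, lifting) F(1) UN_I bad_def card_mono finite_UN insertI1 linorder_not_less
        mem_Collect_eq subsetI insert.hyps(1) finite_subset)
  define F' where "F' = (\<lambda>a. {y \<in> F a. \<not> R x y})"
  have "\<exists>q. (\<forall>a \<in> I. q a \<in> F' a) \<and> (\<forall>a \<in> I. \<forall>b \<in> I. a \<noteq> b \<longrightarrow> \<not> R (q a) (q b))"
  proof (rule insert.IH)
    show "finite (F' a) \<and> selection_bound c (card I) \<le> card (F' a)" if "a \<in> I" for a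
      using x that F(1)[of a] by (auto simp: F'_def bad_def K_def[symmetric] not_less)
    show "\<exists>x \<in> A. \<exists>y \<in> B. \<not> R x y"
      if "a \<in> I" "b \<in> I" "a \<noteq> b" "A \<subseteq> F' a" "B \<subseteq> F' b" "card A = c" "card B = c" for a b A B
      using that by (intro insert.prems(2)[of a b]) (auto simp: F'_def)
  qed
  then obtain q where q: "\<forall>a \<in> I. q a \<in> F' a" "\<forall>a \<in> I. \<forall>b \<in> I. a \<noteq> b \<longrightarrow> \<not> R (q a) (q b)"
    by blast
  have "\<not> R x (q a)" "\<not> R (q a) x" if "a \<in> I" for a
    using q(1) that assms(3) by (auto simp: F'_def)
  then show ?case
    using q x insert.hyps
    by (intro exI[of _ "q(z := x)"]) (auto simp: F'_def)
qed

section \<open>Intersection graphs\<close>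

lemma intersection_graph_simps [simp]:
  "verts (intersection_graph J S) = J"
  "{i, j} \<in> edges (intersection_graph J S) \<longleftrightarrow>
     i \<in> J \<and> j \<in> J \<and> i \<noteq> j \<and> verts (S i) \<inter> verts (S j) \<noteq> {}"
  by (auto simp: intersection_graph_def doubleton_eq_iff)

lemma simple_intersection_graph: "finite J \<Longrightarrow> simple_graph (intersection_graph J S)"
  by (auto simp: intersection_graph_def simple_graph_def card_2_iff)

lemma conn_induced_subgraph_of:
  assumes "simple_graph H" "X \<subseteq> verts H" "conn (edges H) X"
  shows "subgraph_of (induced_subgraph H X) H" "connected_graph (induced_subgraph H X)"
proof -
  have s: "simple_graph (induced_subgraph H X)"
    by (rule simple_graph_induced_subgraph[OF assms(1,2)])
  then show "subgraph_of (induced_subgraph H X) H"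
    using assms(2) by (auto simp: subgraph_of_def edges_induced_subgraph)
  show "connected_graph (induced_subgraph H X)"
    using s assms(3) by (simp add: connected_graph_iff_conn conn_induced_subgraph)
qed

text \<open>What (tw, omega)-boundedness of the class yields for a single host graph
  \<open>H\<close>, once the unknown function is used only for clique numbers at most 2.\<close>

definition triangle_free_width :: "'a sgraph \<Rightarrow> nat \<Rightarrow> bool" where
  "triangle_free_width H w \<longleftrightarrow> (\<forall>(J :: nat set) S. finite J \<longrightarrow>
     (\<forall>j \<in> J. subgraph_of (S j) H \<and> connected_graph (S j)) \<longrightarrow>
     clique_number (intersection_graph J S) \<le> 2 \<longrightarrow>
     treewidth (intersection_graph J S) \<le> int w)"

definition pairs :: "nat \<Rightarrow> (nat \<times> nat) set" where
  "pairs m = {(i, j). i < j \<and> j < m}"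

lemma finite_pairs: "finite (pairs m)"
  by (rule finite_subset[of _ "{..<m} \<times> {..<m}"]) (auto simp: pairs_def)

text \<open>Reed and Wood's grid-like minor: the sets \<open>{P i} \<union> {Q e | i \<in> e}\<close> form a bramble in the
  bipartite intersection graph of the \<open>P i\<close> and \<open>Q e\<close>, and every vertex lies in at most two of them.\<close>

lemma grid_like_minor_bound:
  fixes P :: "nat \<Rightarrow> 'a set" and Q :: "nat \<times> nat \<Rightarrow> 'a set"
  assumes H: "simple_graph H" and w: "triangle_free_width H w"
    and P: "\<And>i. i < m \<Longrightarrow> P i \<subseteq> verts H \<and> conn (edges H) (P i)"
    and Q: "\<And>e. e \<in> pairs m \<Longrightarrow> Q e \<subseteq> verts H \<and> conn (edges H) (Q e)"
    and P_disj: "\<And>i j. i < m \<Longrightarrow> j < m \<Longrightarrow> i \<noteq> j \<Longrightarrow> P i \<inter> P j = {}"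
    and Q_disj: "\<And>e f. e \<in> pairs m \<Longrightarrow> f \<in> pairs m \<Longrightarrow> e \<noteq> f \<Longrightarrow> Q e \<inter> Q f = {}"
    and meet: "\<And>i j. (i, j) \<in> pairs m \<Longrightarrow> Q (i, j) \<inter> P i \<noteq> {} \<and> Q (i, j) \<inter> P j \<noteq> {}"
  shows "m \<le> 2 * (w + 1)"
proof -
  \<comment> \<open>The graphs of the class are indexed by naturals, so segments
    (\<open>Inl\<close>) and connectors (\<open>Inr\<close>) are encoded as naturals.\<close>
  define enc :: "nat + nat \<times> nat \<Rightarrow> nat" where "enc = (\<lambda>x. sum_encode (map_sum id prod_encode x))"
  define dec :: "nat \<Rightarrow> nat + nat \<times> nat" where "dec = (\<lambda>n. map_sum id prod_decode (sum_decode n))"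
  have dec_enc [simp]: "dec (enc x) = x" for x
    by (cases x) (auto simp: enc_def dec_def)
  have enc_eq [simp]: "enc x = enc y \<longleftrightarrow> x = y" for x y
    by (metis dec_enc)
  define I where "I = Inl ` {..<m} \<union> Inr ` pairs m"
  define V where "V = case_sum P Q"
  define S where "S = (\<lambda>n. induced_subgraph H (V (dec n)))"
  define G where "G = intersection_graph (enc ` I) S"
  have finI: "finite I"
    using finite_pairs by (auto simp: I_def)
  have G: "simple_graph G" and VG: "verts G = enc ` I"
    using finI by (auto simp: G_def simple_intersection_graph)
  have edge: "{enc x, enc y} \<in> edges G \<longleftrightarrow> x \<in> I \<and> y \<in> I \<and> x \<noteq> y \<and> V x \<inter> V y \<noteq> {}" for x y
    by (auto simp: G_def S_def)
  have VI: "V x \<subseteq> verts H \<and> conn (edges H) (V x)" if "x \<in> I" for x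
    using that unfolding I_def V_def by (elim UnE imageE) (simp_all add: P Q)
  have "clique_number G \<le> 2"
    unfolding clique_number_le_iff[OF G]
  proof (intro allI impI)
    fix K assume K: "clique_in G K"
    have finK: "finite K"
      using K finI VG by (auto simp: clique_in_def intro: finite_subset)
    \<comment> \<open>A clique contains at most one segment and one connector, because the sets of
      each kind are pairwise disjoint.\<close>
    have side: "card {k \<in> K. isl (dec k) = b} \<le> Suc 0" for b
    proof -
      have "k = l" if kl: "k \<in> K" "l \<in> K" "isl (dec k) = isl (dec l)" for k l
      proof (rule ccontr)
        assume "k \<noteq> l"
        then have e: "{k, l} \<in> edges G"
          using K kl by (auto simp: clique_in_def)
        have "k \<in> enc ` I" "l \<in> enc ` I"
          using K kl unfolding clique_in_def VG by blast+
        then obtain x y where xy: "k = enc x" "l = enc y"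
          by blast
        have V: "x \<in> I" "y \<in> I" "x \<noteq> y" "V x \<inter> V y \<noteq> {}" and "isl x = isl y"
          using e edge kl(3) unfolding xy by auto
        then consider i j where "x = Inl i" "y = Inl j" | e f where "x = Inr e" "y = Inr f"
          by (cases x; cases y) auto
        then show False
        proof cases
          case (1 i j)
          then show False using V P_disj[of i j] by (auto simp: I_def V_def)
        next
          case (2 e f)
          then have "e \<in> pairs m" "f \<in> pairs m" "e \<noteq> f" "Q e \<inter> Q f \<noteq> {}"
            using V by (simp_all add: I_def V_def image_iff)
          then show False using Q_disj by blast
        qed
      qed
      then show ?thesis
        using finK by (subst card_le_Suc0_iff_eq) auto
    qed
    have "K = {k \<in> K. isl (dec k) = True} \<union> {k \<in> K. isl (dec k) = False}"
      by auto
    then have "card K \<le> card {k \<in> K. isl (dec k) = True} + card {k \<in> K. isl (dec k) = False}"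
      by (metis card_Un_le)
    then show "card K \<le> 2"
      using side[of True] side[of False] by linarith
  qed
  moreover have "subgraph_of (S j) H \<and> connected_graph (S j)" if "j \<in> enc ` I" for j
    using that VI conn_induced_subgraph_of[OF H] by (auto simp: S_def)
  ultimately have "treewidth G \<le> int w"
    using w finI unfolding triangle_free_width_def G_def by blast
  then obtain T :: "nat sgraph" and \<beta> where td: "tree_decomposition G T \<beta>"
    and bag: "\<And>t. t \<in> verts T \<Longrightarrow> int (card (\<beta> t)) \<le> int w + 1"
    using treewidth_le_iff[OF G] by blast
  define X where "X = (\<lambda>i. enc ` insert (Inl i) (Inr ` {e \<in> pairs m. fst e = i \<or> snd e = i}))"
  have X_mem: "enc x \<in> X i \<longleftrightarrow> x = Inl i \<or> (\<exists>e \<in> pairs m. x = Inr e \<and> (fst e = i \<or> snd e = i))" for x i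
    unfolding X_def by (auto simp: image_iff)
  have X: "conn (edges G) (X i) \<and> X i \<subseteq> verts G" if i: "i < m" for i
  proof
    have "(enc (Inl i), x) \<in> (adj_in (edges G) (X i))\<^sup>*" if x: "x \<in> X i" for x
    proof (cases "x = enc (Inl i)")
      case False
      then obtain e where e: "x = enc (Inr e)" "e \<in> pairs m" "fst e = i \<or> snd e = i"
        using x by (auto simp: X_def)
      have "P i \<inter> Q e \<noteq> {}"
        using meet[of "fst e" "snd e"] e by auto
      then have "{enc (Inl i), x} \<in> edges G"
        unfolding e(1) edge using e i by (auto simp: I_def V_def)
      then have "(enc (Inl i), x) \<in> adj_in (edges G) (X i)"
        using x by (auto simp: adj_in_def X_def)
      then show ?thesis by blast
    qed simp
    then show "conn (edges G) (X i)"
      by (intro connI_root[of "enc (Inl i)"]) (auto simp: X_def)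
    show "X i \<subseteq> verts G"
      using i unfolding X_def VG I_def by auto
  qed
  have XX: "X i \<inter> X j \<noteq> {}" if ij: "i < m" "j < m" for i j
  proof -
    consider "i = j" | "(i, j) \<in> pairs m" | "(j, i) \<in> pairs m"
      unfolding pairs_def using ij by (cases i j rule: linorder_cases) auto
    then show ?thesis
      by cases (force simp: X_def)+
  qed
  obtain t where t: "t \<in> verts T" "\<And>i. i \<in> {..<m} \<Longrightarrow> \<beta> t \<inter> X i \<noteq> {}"
    using bag_meeting_intersecting_family[OF td, of "{..<m}" X] X XX by auto
  have \<beta>: "\<beta> t \<subseteq> enc ` I"
    using td t(1) VG by (auto simp: tree_decomposition_def)
  then have fin\<beta>: "finite (\<beta> t)"
    using finI by (auto intro: finite_subset)
  have two: "card {i. i < m \<and> v \<in> X i} \<le> 2" if v: "v \<in> \<beta> t" for v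
  proof -
    obtain a b where "{i. i < m \<and> v \<in> X i} \<subseteq> {a, b}"
    proof -
      obtain x where x: "v = enc x" using \<beta> v by auto
      show ?thesis
      proof (cases x)
        case (Inl a)
        then have "{i. i < m \<and> v \<in> X i} \<subseteq> {a, a}" by (auto simp: X_mem x)
        then show ?thesis by (rule that)
      next
        case (Inr e)
        then have "{i. i < m \<and> v \<in> X i} \<subseteq> {fst e, snd e}" by (auto simp: X_mem x)
        then show ?thesis by (rule that)
      qed
    qed
    then have "card {i. i < m \<and> v \<in> X i} \<le> card {a, b}"
      by (intro card_mono) auto
    also have "\<dots> \<le> 2"
      by (simp add: card_insert_if)
    finally show ?thesis .
  qed
  \<comment> \<open>Double counting: the bag meets every \<open>X i\<close>, and each of its
    vertices accounts for at most two indices \<open>i\<close>.\<close>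
  have "{..<m} \<subseteq> (\<Union>v\<in>\<beta> t. {i. i < m \<and> v \<in> X i})"
    using t(2) by fastforce
  then have "card {..<m} \<le> card (\<Union>v\<in>\<beta> t. {i. i < m \<and> v \<in> X i})"
    using fin\<beta> by (intro card_mono) auto
  also have "\<dots> \<le> (\<Sum>v\<in>\<beta> t. card {i. i < m \<and> v \<in> X i})"
    using fin\<beta> by (rule card_UN_le)
  also have "\<dots> \<le> (\<Sum>v\<in>\<beta> t. 2)"
    using two by (intro sum_mono) auto
  finally have "m \<le> 2 * card (\<beta> t)"
    by simp
  also have "\<dots> \<le> 2 * (w + 1)"
    using bag[OF t(1)] by (intro mult_le_mono2) linarith
  finally show ?thesis .
qed

text \<open>Otherwise \<open>m\<close> paths of \<open>A\<close> as segments and paths of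
  \<open>B\<close> as connectors satisfy the hypotheses of \<open>grid_like_minor_bound\<close>, for
  any assignment of distinct paths of \<open>B\<close> to the pairs. The size \<open>m * m\<close>
  leaves room for all pairs.\<close>

lemma no_complete_bipartite_intersection:
  fixes A B :: "'a list set"
  assumes H: "simple_graph H" and w: "triangle_free_width H w" and m: "2 * (w + 1) < m"
    and AB: "\<And>p. p \<in> A \<union> B \<Longrightarrow> walk (edges H) p \<and> set p \<subseteq> verts H"
    and disj: "pairwise (\<lambda>p q. set p \<inter> set q = {}) A" "pairwise (\<lambda>p q. set p \<inter> set q = {}) B"
    and card: "card A = m * m" "card B = m * m"
  shows "\<exists>p \<in> A. \<exists>q \<in> B. set p \<inter> set q = {}"
proof (rule ccontr)
  assume "\<not> ?thesis"
  then have all: "set p \<inter> set q \<noteq> {}" if "p \<in> A" "q \<in> B" for p q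
    using that by blast
  have fin: "finite A" "finite B"
    using card m by (auto intro: card_ge_0_finite)
  obtain f where f: "bij_betw f {..<m * m} A"
    using ex_bij_betw_nat_finite[OF fin(1)] card(1) by (auto simp: atLeast0LessThan)
  obtain g where g: "bij_betw g {..<m * m} B"
    using ex_bij_betw_nat_finite[OF fin(2)] card(2) by (auto simp: atLeast0LessThan)
  \<comment> \<open>Row-by-row numbering, an injection of \<open>pairs m\<close> into
    \<open>{..<m * m}\<close>.\<close>
  define c where "c = (\<lambda>e :: nat \<times> nat. fst e * m + snd e)"
  have c: "c e < m * m" if "e \<in> pairs m" for e
  proof -
    have "Suc (fst e) * m \<le> m * m"
      using that by (intro mult_le_mono1) (auto simp: pairs_def)
    then show ?thesis
      using that by (auto simp: c_def pairs_def)
  qed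
  have c_inj: "e = e'" if "e \<in> pairs m" "e' \<in> pairs m" "c e = c e'" for e e'
  proof -
    have "c d div m = fst d \<and> c d mod m = snd d" if "d \<in> pairs m" for d
    proof -
      have "snd d < m" using that by (auto simp: pairs_def)
      then show ?thesis by (simp add: c_def)
    qed
    then show ?thesis
      using that by (metis prod_eqI)
  qed
  have small: "i < m * m" if "i < m" for i
    using that m by (meson le_square less_le_trans)
  have fA: "f i \<in> A" if "i < m" for i
    using f small[OF that] by (auto simp: bij_betw_def)
  have gB: "g (c e) \<in> B" if "e \<in> pairs m" for e
    using g c[OF that] by (auto simp: bij_betw_def)
  have "m \<le> 2 * (w + 1)"
  proof (rule grid_like_minor_bound[OF H w, of m "\<lambda>i. set (f i)" "\<lambda>e. set (g (c e))"])
    show "set (f i) \<subseteq> verts H \<and> conn (edges H) (set (f i))" if "i < m" for i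
      using AB fA[OF that] conn_walk by blast
    show "set (g (c e)) \<subseteq> verts H \<and> conn (edges H) (set (g (c e)))" if "e \<in> pairs m" for e
      using AB gB[OF that] conn_walk by blast
    show "set (f i) \<inter> set (f j) = {}" if "i < m" "j < m" "i \<noteq> j" for i j
    proof -
      have "f i \<noteq> f j"
        using f small that by (auto simp: bij_betw_def inj_on_def)
      then show ?thesis
        using disj(1) fA that by (auto simp: pairwise_def)
    qed
    show "set (g (c e)) \<inter> set (g (c e')) = {}" if "e \<in> pairs m" "e' \<in> pairs m" "e \<noteq> e'" for e e'
    proof -
      have "g (c e) \<noteq> g (c e')"
        using g c c_inj that by (metis bij_betw_def inj_onD lessThan_iff)
      then show ?thesis
        using disj(2) gB that by (auto simp: pairwise_def)
    qed
    show "set (g (c (i, j))) \<inter> set (f i) \<noteq> {} \<and> set (g (c (i, j))) \<inter> set (f j) \<noteq> {}"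
      if "(i, j) \<in> pairs m" for i j
      using all[OF fA[of i] gB[OF that]] all[OF fA[of j] gB[OF that]] that
      by (auto simp: pairs_def Int_commute)
  qed
  then show False
    using m by simp
qed

text \<open>Here \<open>m\<close> is the least number exceeding \<open>2 * (w + 1)\<close>, and
  \<open>m\<close> times the \<open>Suc\<close> term is the separator size. The \<open>Suc\<close>
  makes the linkage size positive, as the cutting of the path requires.\<close>

definition treewidth_bound :: "nat \<Rightarrow> nat" where
  "treewidth_bound w = (let m = 2 * w + 3 in
     3 * (m * Suc (selection_bound (m * m) (card (pairs m)))))"

lemma treewidth_le_treewidth_bound:
  assumes H: "simple_graph H" and w: "triangle_free_width H w"
  shows "treewidth H \<le> int (treewidth_bound w)"
proof -
  define m where "m = 2 * w + 3"
  define k where "k = Suc (selection_bound (m * m) (card (pairs m)))"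
  have finV: "finite (verts H)" and E2: "\<And>e. e \<in> edges H \<Longrightarrow> card e = 2"
    and E_sub: "\<And>e. e \<in> edges H \<Longrightarrow> e \<subseteq> verts H"
    using H by (auto simp: simple_graph_def)
  have finE: "finite (edges H)"
    using E_sub finV by (auto intro: finite_subset[of _ "Pow (verts H)"])
  have walk_verts: "set p \<subseteq> verts H" if "walk (edges H) p" "hd p \<in> verts H" for p
    using that
  proof (induction p)
    case (Cons a p)
    then show ?case using E_sub by (cases "p = []") (auto simp: walk_Cons)
  qed simp
  have sep: "\<exists>S. finite S \<and> card S \<le> m * k \<and>
      (\<forall>X \<subseteq> verts H. conn (edges H) X \<longrightarrow> X \<inter> S = {} \<longrightarrow> card (X \<inter> W) \<le> m * k)"
    if W: "W \<subseteq> verts H" "card W = 2 * (m * k) + 1" for W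
  proof (rule ccontr)
    assume no: "\<not> ?thesis"
    \<comment> \<open>The connected sets holding a majority of the \<open>2 * (m * k) + 1\<close>
      vertices of \<open>W\<close>. Two majorities share a vertex, and the missing separator says
      that no \<open>m * k\<close> vertices meet all of these sets.\<close>
    define \<B> where "\<B> = {X. X \<subseteq> verts H \<and> conn (edges H) X \<and> m * k < card (X \<inter> W)}"
    have avoid: "\<exists>X\<in>\<B>. X \<inter> S = {}" if "finite S" "card S \<le> m * k" for S
    proof -
      have "\<not> (\<forall>X \<subseteq> verts H. conn (edges H) X \<longrightarrow> X \<inter> S = {} \<longrightarrow> card (X \<inter> W) \<le> m * k)"
        using no that by blast
      then show ?thesis
        by (auto simp: \<B>_def not_le)
    qed
    then have "\<B> \<noteq> {}"
      by (metis card.empty empty_iff finite.emptyI le0)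
    have finW: "finite W"
      using W finV finite_subset by blast
    have meet: "X \<inter> Y \<noteq> {}" if XY: "X \<in> \<B>" "Y \<in> \<B>" for X Y
    proof
      assume "X \<inter> Y = {}"
      then have "card (X \<inter> W) + card (Y \<inter> W) = card ((X \<inter> W) \<union> (Y \<inter> W))"
        using finW by (intro card_Un_disjoint[symmetric]) auto
      also have "\<dots> \<le> card W"
        using finW by (intro card_mono) auto
      finally show False
        using XY W(2) by (auto simp: \<B>_def)
    qed
    have \<B>_conn: "conn (edges H) X \<and> X \<subseteq> verts H" if "X \<in> \<B>" for X
      using that by (simp add: \<B>_def)
    obtain xs where xs: "walk (edges H) xs" "distinct xs" "set xs \<subseteq> verts H"
      "\<forall>X\<in>\<B>. X \<inter> set xs \<noteq> {}"
      using intersecting_family_path[OF finV \<open>\<B> \<noteq> {}\<close> \<B>_conn meet] by blast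
    have "\<exists>P :: nat \<Rightarrow> 'a set. (\<forall>i < m. P i \<subseteq> set xs \<and> conn (edges H) (P i) \<and>
        cover_number_ge k {X \<in> \<B>. X \<inter> P i \<noteq> {}}) \<and>
      (\<forall>i < m. \<forall>j < m. i \<noteq> j \<longrightarrow> P i \<inter> P j = {})"
    proof (rule cut_path_into_segments)
      show "cover_number_ge (m * k) \<B>"
        using avoid by (auto simp: cover_number_ge_def)
    qed (use xs in \<open>auto simp: walk_def k_def\<close>)
    then obtain P :: "nat \<Rightarrow> 'a set" where P0:
      "\<forall>i < m. P i \<subseteq> set xs \<and> conn (edges H) (P i) \<and> cover_number_ge k {X \<in> \<B>. X \<inter> P i \<noteq> {}}"
      and P_disj: "\<forall>i < m. \<forall>j < m. i \<noteq> j \<longrightarrow> P i \<inter> P j = {}"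
      by (elim exE conjE)
    have P: "P i \<subseteq> verts H" "conn (edges H) (P i)" "finite (P i)"
      and cover: "\<And>S. finite S \<Longrightarrow> card S < k \<Longrightarrow> \<exists>X\<in>\<B>. X \<inter> P i \<noteq> {} \<and> X \<inter> S = {}"
      if "i < m" for i
    proof -
      note * = P0[rule_format, OF that]
      show "P i \<subseteq> verts H" "conn (edges H) (P i)"
        using * xs(3) by auto
      then show "finite (P i)"
        using finV finite_subset by blast
      show "\<exists>X\<in>\<B>. X \<inter> P i \<noteq> {} \<and> X \<inter> S = {}" if "finite S" "card S < k" for S
        using * that unfolding cover_number_ge_def by blast
    qed
    \<comment> \<open>For fewer than \<open>k\<close> deleted vertices there are surviving members
      \<open>X\<close> meeting \<open>P i\<close> and \<open>Y\<close> meeting \<open>P j\<close>.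
      They intersect, so \<open>X \<union> Y\<close> is connected and contains a path between the
      segments.\<close>
    have linkage: "\<exists>F. finite F \<and> card F = k \<and> pairwise (\<lambda>p q. set p \<inter> set q = {}) F \<and>
        (\<forall>p \<in> F. link (edges H) (P i) (P j) p)" if ij: "i < m" "j < m" for i j
    proof (rule menger[OF finE E2])
      show "finite (P i)" "finite (P j)" using P ij by auto
      fix S :: "'a set" assume S: "finite S" "card S < k"
      obtain X where X: "X \<in> \<B>" "X \<inter> P i \<noteq> {}" "X \<inter> S = {}"
        using cover[OF ij(1) S] by blast
      obtain Y where Y: "Y \<in> \<B>" "Y \<inter> P j \<noteq> {}" "Y \<inter> S = {}"
        using cover[OF ij(2) S] by blast
      obtain a b where ab: "a \<in> X" "a \<in> P i" "b \<in> Y" "b \<in> P j"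
        using X Y by blast
      have "conn (edges H) (X \<union> Y)"
        using X(1) Y(1) meet by (intro conn_Un) (auto simp: \<B>_def)
      then obtain p where "walk (edges H) p" "distinct p" "hd p = a" "last p = b" "set p \<subseteq> X \<union> Y"
        using conn_walk_exists[of "edges H" "X \<union> Y" a b] ab by blast
      then show "\<exists>p. link (edges H) (P i) (P j) p \<and> set p \<inter> S = {}"
        using ab X Y by (intro exI[of _ p]) (auto simp: link_def)
    qed
    have "\<forall>e\<in>pairs m. \<exists>F. finite F \<and> card F = k \<and> pairwise (\<lambda>p q. set p \<inter> set q = {}) F \<and>
        (\<forall>p \<in> F. link (edges H) (P (fst e)) (P (snd e)) p)"
      using linkage by (auto simp: pairs_def)
    then obtain F where F: "\<And>e. e \<in> pairs m \<Longrightarrow> finite (F e) \<and> card (F e) = k \<and>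
        pairwise (\<lambda>p q. set p \<inter> set q = {}) (F e) \<and>
        (\<forall>p \<in> F e. link (edges H) (P (fst e)) (P (snd e)) p)"
      by metis
    have F_walk: "walk (edges H) p \<and> hd p \<in> P (fst e) \<and> last p \<in> P (snd e) \<and> set p \<subseteq> verts H"
      if "e \<in> pairs m" "p \<in> F e" for e p
    proof -
      have l: "link (edges H) (P (fst e)) (P (snd e)) p"
        using F that by blast
      moreover have "P (fst e) \<subseteq> verts H"
        using that(1) by (intro P) (auto simp: pairs_def)
      ultimately show ?thesis
        using walk_verts by (auto simp: link_def)
    qed
    \<comment> \<open>Paths are related if they meet; the forbidden completely related subfamilies
      are those of \<open>no_complete_bipartite_intersection\<close>.\<close>
    have "\<exists>q. (\<forall>a \<in> pairs m. q a \<in> F a) \<and>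
        (\<forall>a \<in> pairs m. \<forall>b \<in> pairs m. a \<noteq> b \<longrightarrow> \<not> set (q a) \<inter> set (q b) \<noteq> {})"
    proof (rule select_unrelated[OF finite_pairs, where c = "m * m"])
      show "finite (F a) \<and> selection_bound (m * m) (card (pairs m)) \<le> card (F a)" if "a \<in> pairs m" for a
        using F[OF that] by (auto simp: k_def)
      show "\<exists>x \<in> A. \<exists>y \<in> B. \<not> set x \<inter> set y \<noteq> {}"
        if ab: "a \<in> pairs m" "b \<in> pairs m" "a \<noteq> b" "A \<subseteq> F a" "B \<subseteq> F b"
          "card A = m * m" "card B = m * m" for a b A B
      proof -
        have "\<exists>x \<in> A. \<exists>y \<in> B. set x \<inter> set y = {}"
        proof (rule no_complete_bipartite_intersection[OF H w])
          show "2 * (w + 1) < m" by (simp add: m_def)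
          show "walk (edges H) p \<and> set p \<subseteq> verts H" if "p \<in> A \<union> B" for p
            using that F_walk ab by blast
          show "pairwise (\<lambda>p q. set p \<inter> set q = {}) A" "pairwise (\<lambda>p q. set p \<inter> set q = {}) B"
            using F ab pairwise_subset by blast+
        qed (use ab in auto)
        then show ?thesis by blast
      qed
    qed (auto simp: Int_commute)
    then obtain q where q: "\<And>e. e \<in> pairs m \<Longrightarrow> q e \<in> F e"
      "\<And>e f. e \<in> pairs m \<Longrightarrow> f \<in> pairs m \<Longrightarrow> e \<noteq> f \<Longrightarrow> set (q e) \<inter> set (q f) = {}"
      by blast
    have "m \<le> 2 * (w + 1)"
    proof (rule grid_like_minor_bound[OF H w, of m P "\<lambda>e. set (q e)"])
      show "set (q e) \<subseteq> verts H \<and> conn (edges H) (set (q e))" if "e \<in> pairs m" for e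
        using F_walk[OF that q(1)[OF that]] conn_walk by blast
      show "set (q (i, j)) \<inter> P i \<noteq> {} \<and> set (q (i, j)) \<inter> P j \<noteq> {}" if "(i, j) \<in> pairs m" for i j
      proof -
        have *: "walk (edges H) (q (i, j))" "hd (q (i, j)) \<in> P i" "last (q (i, j)) \<in> P j"
          using F_walk[OF that q(1)[OF that]] by auto
        then have "q (i, j) \<noteq> []"
          by (simp add: walk_def)
        then show ?thesis
          using * hd_in_set last_in_set by blast
      qed
    qed (use P P_disj q(2) in auto)
    then show False
      by (simp add: m_def)
  qed
  have "decomposable (edges H) (3 * (m * k) + 1) (verts H) {}"
    using sep E2 finV by (intro decomposable_if_balanced_separators[where V = "verts H"]) auto
  then have "treewidth H \<le> int (3 * (m * k))"
    unfolding Suc_eq_plus1[symmetric] by (rule treewidth_le_of_decomposable[OF H])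
  then show ?thesis
    by (simp add: treewidth_bound_def Let_def m_def k_def)
qed

section \<open>The equivalence\<close>

lemma bounded_treewidth_if_tw_omega_bounded:
  assumes simple: "\<And>G. G \<in> \<G> \<Longrightarrow> simple_graph G"
    and bounded: "tw_omega_bounded (intersection_class \<G>)"
  shows "bounded_treewidth \<G>"
proof -
  obtain f where f: "\<And>G X. G \<in> intersection_class \<G> \<Longrightarrow> X \<subseteq> verts G \<Longrightarrow>
      treewidth (induced_subgraph G X) \<le> int (f (clique_number (induced_subgraph G X)))"
    using bounded by (auto simp: tw_omega_bounded_def)
  \<comment> \<open>The function \<open>f\<close> need not be monotone, hence a maximum in place of
    \<open>f 2\<close>. It does not depend on \<open>H\<close>, so the resulting treewidth bound is
    uniform over the class.\<close>
  define w where "w = Max (f ` {..2})"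
  have "triangle_free_width H w" if H: "H \<in> \<G>" for H
    unfolding triangle_free_width_def
  proof (intro allI impI)
    fix J :: "nat set" and S
    assume J: "finite J" "\<forall>j\<in>J. subgraph_of (S j) H \<and> connected_graph (S j)"
      and cl: "clique_number (intersection_graph J S) \<le> 2"
    let ?G = "intersection_graph J S"
    have "?G \<in> intersection_class \<G>"
      using J H unfolding intersection_class_def by blast
    then have "treewidth ?G \<le> int (f (clique_number ?G))"
      using f[of ?G "verts ?G"] induced_subgraph_self[OF simple_intersection_graph[OF J(1)], of S] by simp
    also have "\<dots> \<le> int w"
      using cl unfolding w_def by (intro of_nat_mono Max_ge) auto
    finally show "treewidth ?G \<le> int w" .
  qed
  then show ?thesis
    using treewidth_le_treewidth_bound simple unfolding bounded_treewidth_def by blast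
qed

section \<open>From bounded treewidth to bounded tree-independence number\<close>

lemma tree_independence_intersection_graph:
  assumes H: "simple_graph H" and J: "finite J"
    and S: "\<And>j. j \<in> J \<Longrightarrow> subgraph_of (S j) H \<and> connected_graph (S j)"
    and tw: "treewidth H \<le> int k"
  shows "tree_independence_number (intersection_graph J S) \<le> Suc k"
proof -
  let ?G = "intersection_graph J S"
  obtain T :: "nat sgraph" and \<beta> where td: "tree_decomposition H T \<beta>"
    and bag: "\<And>t. t \<in> verts T \<Longrightarrow> int (card (\<beta> t)) \<le> int k + 1"
    using tw treewidth_le_iff[OF H] by blast
  have T: "tree_graph T" and \<beta>: "\<And>t. t \<in> verts T \<Longrightarrow> \<beta> t \<subseteq> verts H"
    and vertex: "\<And>v. v \<in> verts H \<Longrightarrow> \<exists>t\<in>verts T. v \<in> \<beta> t"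
    using td by (auto simp: tree_decomposition_def)
  have S_sub: "verts (S j) \<subseteq> verts H" and S_conn: "conn (edges H) (verts (S j))" if "j \<in> J" for j
    using S[OF that] connected_graph_iff_conn conn_mono by (auto simp: subgraph_of_def)
  define \<gamma> where "\<gamma> = (\<lambda>t. {j \<in> J. \<beta> t \<inter> verts (S j) \<noteq> {}})"
  have "tree_decomposition ?G T \<gamma>"
    unfolding tree_decomposition_def
  proof (intro conjI ballI)
    show "tree_graph T" by fact
    show "\<gamma> t \<subseteq> verts ?G" for t by (auto simp: \<gamma>_def)
  next
    fix j assume j: "j \<in> verts ?G"
    then obtain v where "v \<in> verts (S j)"
      using S_conn[of j] by (auto simp: conn_def)
    moreover from this obtain t where "t \<in> verts T" "v \<in> \<beta> t"
      using vertex S_sub[of j] j by auto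
    ultimately show "\<exists>t\<in>verts T. j \<in> \<gamma> t"
      using j by (auto simp: \<gamma>_def)
    have "{t \<in> verts T. j \<in> \<gamma> t} = {t \<in> verts T. \<beta> t \<inter> verts (S j) \<noteq> {}}"
      using j by (auto simp: \<gamma>_def)
    moreover have "conn (edges T) {t \<in> verts T. \<beta> t \<inter> verts (S j) \<noteq> {}}"
      using j by (intro tree_decomposition_node_set_conn[OF td] S_conn S_sub) simp_all
    ultimately show "tree_graph (induced_subgraph T {t \<in> verts T. j \<in> \<gamma> t})"
      using tree_graph_induced_subgraph_iff[OF T, of "{t \<in> verts T. j \<in> \<gamma> t}"] by simp
  next
    fix e assume "e \<in> edges ?G"
    then obtain i j where e: "e = {i, j}" "i \<in> J" "j \<in> J" "verts (S i) \<inter> verts (S j) \<noteq> {}"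
      by (auto simp: intersection_graph_def)
    then obtain v where v: "v \<in> verts (S i)" "v \<in> verts (S j)" by auto
    then obtain t where "t \<in> verts T" "v \<in> \<beta> t"
      using vertex S_sub e by blast
    then show "\<exists>t\<in>verts T. e \<subseteq> \<gamma> t"
      using v e by (auto simp: \<gamma>_def)
  qed
  moreover have "card A \<le> Suc k" if t: "t \<in> verts T" and A: "A \<subseteq> \<gamma> t" "independent_in ?G A" for t A
  proof -
    \<comment> \<open>Each member of an independent set has a vertex in the old bag. Nonadjacent
      members are disjoint, so these vertices are distinct, and the old bag has at most
      \<open>Suc k\<close> of them.\<close>
    have "\<forall>j\<in>A. \<exists>v. v \<in> \<beta> t \<inter> verts (S j)"
      using A by (auto simp: \<gamma>_def)
    then obtain r where r: "\<And>j. j \<in> A \<Longrightarrow> r j \<in> \<beta> t \<inter> verts (S j)"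
      by metis
    have "inj_on r A"
    proof (rule inj_onI)
      fix i j assume ij: "i \<in> A" "j \<in> A" "r i = r j"
      then have "r i \<in> verts (S i) \<inter> verts (S j)"
        using r[OF ij(1)] r[OF ij(2)] by auto
      moreover have "{i, j} \<notin> edges ?G" "i \<in> J" "j \<in> J"
        using A ij by (auto simp: independent_in_def)
      ultimately show "i = j" by auto
    qed
    moreover have "finite (\<beta> t)"
      using \<beta>[OF t] H by (auto simp: simple_graph_def intro: finite_subset)
    ultimately have "card A \<le> card (\<beta> t)"
      using r by (intro card_inj_on_le[of r]) auto
    then show ?thesis
      using bag[OF t] by linarith
  qed
  ultimately show ?thesis
    using tree_independence_number_le_iff[OF simple_intersection_graph[OF J]] by blast
qed

lemma bounded_tree_independence_if_bounded_treewidth: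
  assumes simple: "\<And>G. G \<in> \<G> \<Longrightarrow> simple_graph G" and "bounded_treewidth \<G>"
  shows "bounded_tree_independence (intersection_class \<G>)"
proof -
  obtain k where k: "\<And>G. G \<in> \<G> \<Longrightarrow> treewidth G \<le> int k"
    using assms(2) by (auto simp: bounded_treewidth_def)
  show ?thesis
    unfolding bounded_tree_independence_def
  proof (intro exI[of _ "Suc k"] ballI)
    fix G assume "G \<in> intersection_class \<G>"
    then obtain J S H where G: "G = intersection_graph J S" and "H \<in> \<G>" "finite J"
      "\<forall>j \<in> J. subgraph_of (S j) H \<and> connected_graph (S j)"
      unfolding intersection_class_def by blast
    then show "tree_independence_number G \<le> Suc k"
      unfolding G using k simple by (intro tree_independence_intersection_graph) auto
  qed
qed

section \<open>From bounded tree-independence number to (tw, omega)-boundedness\<close>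

lemma tree_decomposition_induced_subgraph:
  assumes td: "tree_decomposition G T \<beta>" and X: "X \<subseteq> verts G"
  shows "tree_decomposition (induced_subgraph G X) T (\<lambda>t. \<beta> t \<inter> X)"
proof -
  have "{t \<in> verts T. v \<in> \<beta> t \<inter> X} = {t \<in> verts T. v \<in> \<beta> t}" if "v \<in> X" for v
    using that by auto
  moreover have "\<exists>t\<in>verts T. e \<subseteq> \<beta> t \<inter> X" if "e \<in> edges G" "e \<subseteq> X" for e
    using td that unfolding tree_decomposition_def by (metis le_inf_iff)
  ultimately show ?thesis
    using td X unfolding tree_decomposition_def edges_induced_subgraph by auto
qed

lemma tw_omega_bounded_if_bounded_tree_independence:
  assumes simple: "\<And>G. G \<in> \<C> \<Longrightarrow> simple_graph G" and "bounded_tree_independence \<C>"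
  shows "tw_omega_bounded \<C>"
proof -
  obtain k where k: "\<And>G. G \<in> \<C> \<Longrightarrow> tree_independence_number G \<le> k"
    using assms(2) by (auto simp: bounded_tree_independence_def)
  \<comment> \<open>The function \<open>f\<close> will be the Ramsey number for cliques of size
    \<open>Suc c\<close> and independent sets of size \<open>Suc k\<close>, each one too large for a
    bag restricted to \<open>X\<close>.\<close>
  have "\<forall>c. \<exists>r\<ge>1. \<forall>(V :: 'a set) (E :: 'a set set). finite V \<and> card V \<ge> r \<longrightarrow>
      (\<exists>R \<subseteq> V. card R = Suc c \<and> clique R E \<or> card R = Suc k \<and> indep R E)"
    using ramsey2 by blast
  then obtain f where f: "\<And>c (V :: 'a set) (E :: 'a set set). finite V \<Longrightarrow> f c \<le> card V \<Longrightarrow>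
      \<exists>R \<subseteq> V. card R = Suc c \<and> clique R E \<or> card R = Suc k \<and> indep R E"
    by metis
  show ?thesis
    unfolding tw_omega_bounded_def
  proof (intro exI[of _ f] ballI allI impI)
    fix G X assume G: "G \<in> \<C>" and X: "X \<subseteq> verts G"
    let ?H = "induced_subgraph G X"
    define c where "c = clique_number ?H"
    have simple_H: "simple_graph ?H"
      using simple_graph_induced_subgraph simple G X by blast
    \<comment> \<open>The independence bound is available for members of the class, so
      \<open>G\<close> is decomposed and the bags are then restricted to \<open>X\<close>.\<close>
    obtain T :: "nat sgraph" and \<beta> where td: "tree_decomposition G T \<beta>"
      and ind: "\<forall>t \<in> verts T. \<forall>A \<subseteq> \<beta> t. independent_in G A \<longrightarrow> card A \<le> k"
      using k[OF G] unfolding tree_independence_number_le_iff[OF simple[OF G]] by blast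
    have "card (\<beta> t \<inter> X) < f c" if t: "t \<in> verts T" for t
    proof (rule ccontr)
      assume "\<not> card (\<beta> t \<inter> X) < f c"
      moreover have "finite (\<beta> t \<inter> X)"
        using X simple[OF G] by (auto simp: simple_graph_def intro: finite_subset)
      ultimately obtain R where R: "R \<subseteq> \<beta> t \<inter> X"
        "card R = Suc c \<and> clique R (edges G) \<or> card R = Suc k \<and> indep R (edges G)"
        using f[of "\<beta> t \<inter> X" c "edges G"] by auto
      from R(2) show False
      proof (elim disjE conjE)
        assume *: "card R = Suc c" "clique R (edges G)"
        then have "clique_in ?H R"
          using R(1) by (auto simp: clique_in_def clique_def edges_induced_subgraph)
        then have "card R \<le> c"
          using clique_number_le_iff[OF simple_H, of c] by (simp add: c_def)
        then show False using * by simp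
      next
        assume *: "card R = Suc k" "indep R (edges G)"
        then have "independent_in G R"
          using R(1) X no_loop[OF simple[OF G]] unfolding independent_in_def indep_def by blast
        then have "card R \<le> k"
          using ind t R(1) by blast
        then show False using * by simp
      qed
    qed
    then have "\<forall>t\<in>verts T. int (card (\<beta> t \<inter> X)) \<le> int (f c) + 1"
      by fastforce
    then show "treewidth ?H \<le> int (f (clique_number ?H))"
      using treewidth_le_iff[OF simple_H] tree_decomposition_induced_subgraph[OF td X]
      unfolding c_def by blast
  qed
qed

theorem theorem5p5:
  fixes \<G> :: "'a sgraph set"
  assumes "\<And>G. G \<in> \<G> \<Longrightarrow> simple_graph G"
  shows "(tw_omega_bounded (intersection_class \<G>) \<longleftrightarrow>
            bounded_tree_independence (intersection_class \<G>)) \<and>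
         (bounded_tree_independence (intersection_class \<G>) \<longleftrightarrow> bounded_treewidth \<G>)"
proof -
  have "simple_graph G" if "G \<in> intersection_class \<G>" for G
    using that by (auto simp: intersection_class_def simple_intersection_graph)
  then show ?thesis
    using bounded_treewidth_if_tw_omega_bounded[of \<G>] assms
      bounded_tree_independence_if_bounded_treewidth[of \<G>]
      tw_omega_bounded_if_bounded_tree_independence[of "intersection_class \<G>"] by blast
qed

end
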